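(* Each first order critical hole (FOCH) for the doubling map is one of the following: \begin{itemize} \item $(a,1/2)$ or $(1/2,1-a)$ for some $a\in(0,1/4]$; \item $(a,a+1/4)$, where $a\in\mathcal S$; \item $(s^\infty,b)$, where $s=\omega_r^-$ for some $r\in\mathbb Q\cap(0,1)$ and $b\in[ts^\infty,t^\infty]$ with $t=\omega_r^+$; \item $(a,t^\infty)$ with $a\in(s^\infty,st^\infty]$, where $s=\omega_r^-$, $t=\omega_r^+$ for some $r\in\mathbb Q\cap(0,1)$. \end{itemize} Consequently, the length of a FOCH can take an arbitrary value between $1/4$ and $1/2$.
   Context: Doubling map: $T:[0,1]\to[0,1]$, $Tx=2x$ for $x\in[0,1/2]$, $Tx=2x-1$ for $x\in(1/2,1]$. For $0<a<b<1$ (a "hole" $(a,b)$) put $\mathcal J(a,b)=\{x\in[0,1]: T^nx\notin(a,b)\text{ for all }n\ge0\}$. A hole $(a_0,b_0)$ is a first order critical hole (FOCH) if: (1) for any hole $(a,b)$ with $a<a_0$, $b>b_0$ we have $\mathcal J(a,b)=\{0,1\}$; and (2) for any hole $(a,b)$ with $a>a_0$, $b<b_0$ we have $\mathcal J(a,b)\ne\{0,1\}$. Words have letters in $\{0,1\}$; $u^\infty=uuu\cdots$, $|u|$ is the length of $u$ and $|u|_1$ the number of 1s. An infinite word $w_1w_2\dots$ is identified with the real number $\sum_{n\ge1}w_n2^{-n}$. A word is balanced if any two of its factors $u,v$ of equal length satisfy $||u|_1-|v|_1|\le1$; a finite word $w$ is cyclically balanced if $w^2$ is balanced. For $r=p/q\in\mathbb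 Q\cap(0,1)$ in lowest terms, $\omega_r^-$ is the lexicographically largest cyclically balanced word of length $q$ with exactly $p$ ones beginning with 0, and $\omega_r^+$ is the lexicographically smallest cyclically balanced word of length $q$ with exactly $p$ ones beginning with 1. $\Delta(r)=[(\omega_r^-)^\infty,\ \omega_r^-(\omega_r^+)^\infty]$ and $\mathcal S=(1/4,1/2)\setminus\bigcup_{r\in\mathbb Q\cap(0,1)}\Delta(r)$. *)

theory Defs
  imports
    "HOL-Analysis.Analysis"
    "HOL-Library.Stream"
    "HOL-Library.Sublist"
    "HOL-Library.List_Lexorder"
begin

definition doubling :: "real \<Rightarrow> real" where
  "doubling x = (if x \<le> 1/2 then 2 * x else 2 * x - 1)"

definition hole :: "real \<Rightarrow> real \<Rightarrow> bool" where
  "hole a b \<longleftrightarrow> 0 < a \<and> a < b \<and> b < 1"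

definition avoiding_set :: "real \<Rightarrow> real \<Rightarrow> real set" where
  "avoiding_set a b = {x \<in> {0..1}. \<forall>n. (doubling ^^ n) x \<notin> {a<..<b}}"

definition FOCH :: "real \<Rightarrow> real \<Rightarrow> bool" where
  "FOCH a0 b0 \<longleftrightarrow> hole a0 b0
     \<and> (\<forall>a b. hole a b \<and> a < a0 \<and> b > b0 \<longrightarrow> avoiding_set a b = {0, 1})
     \<and> (\<forall>a b. hole a b \<and> a > a0 \<and> b < b0 \<longrightarrow> avoiding_set a b \<noteq> {0, 1})"

text \<open>
  The letters 0 and 1 are \<^const>\<open>False\<close> and \<^const>\<open>True\<close>; finite words are lists and infinite
  words are streams, so that \<open>u @- cycle v\<close> is the infinite word \<open>u v v v \<dots>\<close> for nonempty \<open>v\<close>.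
  The order on finite words is the lexicographic one of \<open>List_Lexorder\<close>.
  Stream positions start at 0, which shifts the exponents in the binary value by one.
\<close>

definition word_value :: "bool stream \<Rightarrow> real" where
  "word_value w = (\<Sum>n. of_bool (w !! n) / 2 ^ Suc n)"

definition balanced_word :: "bool list \<Rightarrow> bool" where
  "balanced_word w \<longleftrightarrow>
     (\<forall>u v. sublist u w \<and> sublist v w \<and> length u = length v \<longrightarrow>
        \<bar>int (count_list u True) - int (count_list v True)\<bar> \<le> 1)"

definition cyclically_balanced :: "bool list \<Rightarrow> bool" where
  "cyclically_balanced w \<longleftrightarrow> balanced_word (w @ w)"

text \<open>\<^const>\<open>quotient_of\<close> returns numerator and denominator in lowest terms.\<close>

definition balanced_words_of :: "rat \<Rightarrow> bool list set" where
  "balanced_words_of r =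
     {w. cyclically_balanced w
         \<and> int (length w) = snd (quotient_of r)
         \<and> int (count_list w True) = fst (quotient_of r)}"

definition omega_minus :: "rat \<Rightarrow> bool list" where
  "omega_minus r = Max {w \<in> balanced_words_of r. hd w = False}"

definition omega_plus :: "rat \<Rightarrow> bool list" where
  "omega_plus r = Min {w \<in> balanced_words_of r. hd w = True}"

definition Delta :: "rat \<Rightarrow> real set" where
  "Delta r = {word_value (cycle (omega_minus r)) ..
              word_value (omega_minus r @- cycle (omega_plus r))}"

definition S_set :: "real set" where
  "S_set = {1/4<..<1/2} - (\<Union>r\<in>{0<..<1}. Delta r)"

end

theory Submission
  imports Defs
begin

text \<open>
  For a slope \<open>\<gamma>\<close> put \<open>L \<gamma> = (\<Sum>n. \<lceil>n\<gamma>\<rceil> / 2 ^ n) / 4\<close> and \<open>U \<gamma> = 1/2 + (\<Sum>n. \<lfloor>n\<gamma>\<rfloor> / 2 ^ n) / 4\<close>.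
  The points whose binary digits code the rotation by \<open>\<gamma>\<close> avoid \<open>(L \<gamma>, U \<gamma>)\<close>. Conversely, an orbit
  avoiding a hole \<open>(a, b) \<ni> 1/2\<close> longer than \<open>1/4\<close> ends up in an interval shorter than \<open>1/2\<close>, which
  makes its digit sequence balanced; it then has a rotation number \<open>\<gamma>\<close>, and starting at a position
  where the discrepancy of the digit counts is extremal gives \<open>L \<gamma> \<le> a\<close> and \<open>b \<le> U \<gamma>\<close>.
  As \<open>\<gamma>\<close> increases, the intervals \<open>[L \<gamma>, U \<gamma> - 1/4]\<close> sweep out \<open>(1/4, 1/2)\<close>; they degenerate to
  points for irrational \<open>\<gamma>\<close> and are the intervals \<open>\<Delta>(r)\<close> for rational \<open>\<gamma> = r\<close>.
\<close>

subsection \<open>Binary series of Beatty sequences\<close>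

text \<open>The endpoints in the overview are \<open>L \<gamma> = ceil_sum \<gamma> / 4\<close> and
  \<open>U \<gamma> = 1/2 + floor_sum \<gamma> / 4\<close>.\<close>

definition floor_sum :: "real \<Rightarrow> real" where
  "floor_sum \<gamma> = (\<Sum>n. of_int \<lfloor>real n * \<gamma>\<rfloor> / 2 ^ n)"

definition ceil_sum :: "real \<Rightarrow> real" where
  "ceil_sum \<gamma> = (\<Sum>n. of_int \<lceil>real n * \<gamma>\<rceil> / 2 ^ n)"

lemma sums_n_div_2_power: "(\<lambda>n. real n / 2 ^ n) sums 2"
proof -
  have "(\<lambda>n. real (Suc n) * (1/2) ^ n) sums (1 / (1 - 1/2)\<^sup>2)"
    by (rule geometric_deriv_sums) simp
  then have "(\<lambda>n. real (Suc n) * (1/2) ^ n * (1/2)) sums (1 / (1 - 1/2)\<^sup>2 * (1/2))"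
    by (rule sums_mult2)
  then have "(\<lambda>n. real (Suc n) / 2 ^ Suc n) sums 2"
    by (simp add: power_one_over power2_eq_square field_simps)
  then show ?thesis
    by (subst (asm) sums_Suc_iff) simp
qed

lemma sums_1_div_2_power: "(\<lambda>n. 1 / 2 ^ n :: real) sums 2"
  using geometric_sums[of "1/2::real"] by (simp add: power_one_over)

lemma summable_linear_div_2_power:
  fixes h :: "nat \<Rightarrow> real"
  assumes "\<And>n. \<bar>h n\<bar> \<le> real n + 1"
  shows "summable (\<lambda>n. h n / 2 ^ n)"
proof (rule summable_comparison_test)
  show "\<exists>N. \<forall>n\<ge>N. norm (h n / 2 ^ n) \<le> real n / 2 ^ n + 1 / 2 ^ n"
    using assms by (auto simp: add_divide_distrib[symmetric] divide_right_mono)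
  show "summable (\<lambda>n. real n / 2 ^ n + 1 / 2 ^ n :: real)"
    using sums_n_div_2_power sums_1_div_2_power by (intro summable_add) (auto dest: sums_summable)
qed

lemma abs_floor_ceil_le:
  fixes \<gamma> :: real
  assumes "0 \<le> \<gamma>" "\<gamma> \<le> 1"
  shows "\<bar>real_of_int \<lfloor>real n * \<gamma>\<rfloor>\<bar> \<le> real n" "\<bar>real_of_int \<lceil>real n * \<gamma>\<rceil>\<bar> \<le> real n"
proof -
  have "0 \<le> real n * \<gamma>" "real n * \<gamma> \<le> real n"
    using assms by (auto simp: mult_left_le)
  moreover from this have "0 \<le> \<lfloor>real n * \<gamma>\<rfloor>" "\<lfloor>real n * \<gamma>\<rfloor> \<le> int n"
    "0 \<le> \<lceil>real n * \<gamma>\<rceil>" "\<lceil>real n * \<gamma>\<rceil> \<le> int n"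
    by linarith+
  ultimately show "\<bar>real_of_int \<lfloor>real n * \<gamma>\<rfloor>\<bar> \<le> real n" "\<bar>real_of_int \<lceil>real n * \<gamma>\<rceil>\<bar> \<le> real n"
    by linarith+
qed

lemma summable_floor_sum:
  assumes "0 \<le> \<gamma>" "\<gamma> \<le> 1"
  shows "summable (\<lambda>n. of_int \<lfloor>real n * \<gamma>\<rfloor> / 2 ^ n :: real)"
  by (rule summable_linear_div_2_power) (smt (verit) abs_floor_ceil_le[OF assms])

lemma summable_ceil_sum:
  assumes "0 \<le> \<gamma>" "\<gamma> \<le> 1"
  shows "summable (\<lambda>n. of_int \<lceil>real n * \<gamma>\<rceil> / 2 ^ n :: real)"
  by (rule summable_linear_div_2_power) (smt (verit) abs_floor_ceil_le[OF assms])

lemma floor_sum_0: "floor_sum 0 = 0" and ceil_sum_1: "ceil_sum 1 = 2"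
  using sums_n_div_2_power by (simp_all add: floor_sum_def ceil_sum_def sums_unique[symmetric])

text \<open>Exchanging the letters 0 and 1 turns slope \<open>\<gamma>\<close> into
  \<open>1 - \<gamma>\<close>, since \<open>\<lceil>n - x\<rceil> = n - \<lfloor>x\<rfloor>\<close>;
  this transfers bounds on \<open>ceil_sum\<close> to \<open>floor_sum\<close>.\<close>

lemma ceil_sum_reflect:
  assumes "0 \<le> \<gamma>" "\<gamma> \<le> 1"
  shows "ceil_sum (1 - \<gamma>) = 2 - floor_sum \<gamma>"
proof -
  have "real_of_int \<lceil>real n * (1 - \<gamma>)\<rceil> = real n - of_int \<lfloor>real n * \<gamma>\<rfloor>" for n
  proof -
    have "\<lceil>real n * (1 - \<gamma>)\<rceil> = \<lceil>of_int (int n) + - (real n * \<gamma>)\<rceil>"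
      by (simp add: algebra_simps)
    also have "\<dots> = int n - \<lfloor>real n * \<gamma>\<rfloor>"
      unfolding ceiling_def by linarith
    finally show ?thesis by simp
  qed
  then have "ceil_sum (1 - \<gamma>) = (\<Sum>n. real n / 2 ^ n - of_int \<lfloor>real n * \<gamma>\<rfloor> / 2 ^ n)"
    by (simp add: ceil_sum_def diff_divide_distrib)
  also have "\<dots> = 2 - floor_sum \<gamma>"
    unfolding floor_sum_def
    using sums_diff[OF sums_n_div_2_power summable_sums[OF summable_floor_sum[OF assms]]]
    by (rule sums_unique[symmetric])
  finally show ?thesis .
qed

text \<open>Gives \<open>U \<gamma> > 1/2\<close>, so that the upper points of a rotation orbit use
  the branch \<open>2x - 1\<close>.\<close>

lemma floor_sum_pos:
  assumes "0 < \<gamma>" "\<gamma> < 1"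
  shows "0 < floor_sum \<gamma>"
proof -
  obtain n where n: "1 < real n * \<gamma>"
    using assms(1) reals_Archimedean3 by blast
  have "0 < (\<Sum>n. real_of_int \<lfloor>real n * \<gamma>\<rfloor> / 2 ^ n)"
  proof (rule suminf_pos2)
    show "summable (\<lambda>n. of_int \<lfloor>real n * \<gamma>\<rfloor> / 2 ^ n :: real)"
      using assms by (intro summable_floor_sum) auto
    have "1 \<le> \<lfloor>real n * \<gamma>\<rfloor>" using n by linarith
    then show "0 < real_of_int \<lfloor>real n * \<gamma>\<rfloor> / 2 ^ n" by simp
  qed (use assms in simp)
  then show ?thesis by (simp add: floor_sum_def)
qed

lemma floor_sum_mono:
  assumes "0 \<le> \<gamma>" "\<gamma> \<le> \<delta>" "\<delta> \<le> 1"
  shows "floor_sum \<gamma> \<le> floor_sum \<delta>"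
  unfolding floor_sum_def using assms
  by (intro suminf_le summable_floor_sum divide_right_mono)
     (auto intro!: floor_mono mult_left_mono)

text \<open>Each term with \<open>n > 0\<close> is at least \<open>1 / 2^n\<close>. Hence
  \<open>L \<gamma> \<ge> 1/4\<close>.\<close>

lemma ceil_sum_ge_1:
  assumes "0 < \<gamma>" "\<gamma> \<le> 1"
  shows "1 \<le> ceil_sum \<gamma>"
proof -
  have "(\<lambda>n. 1 / 2 ^ n - (if n = 0 then 1 else 0) :: real) sums (2 - 1)"
    using sums_1_div_2_power sums_single[of 0 "\<lambda>_. 1::real"] by (intro sums_diff) auto
  moreover have "ceil_sum \<gamma> = (\<Sum>n. of_int \<lceil>real n * \<gamma>\<rceil> / 2 ^ n)"
    by (simp add: ceil_sum_def)
  moreover have "1 / 2 ^ n - (if n = 0 then 1 else 0) \<le> real_of_int \<lceil>real n * \<gamma>\<rceil> / 2 ^ n" for n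
  proof (cases "n = 0")
    case False
    then have "0 < real n * \<gamma>" using assms by simp
    then have "1 \<le> \<lceil>real n * \<gamma>\<rceil>" by linarith
    then have "1 / 2 ^ n \<le> real_of_int \<lceil>real n * \<gamma>\<rceil> / 2 ^ n"
      by (intro divide_right_mono) auto
    with False show ?thesis by simp
  qed simp
  moreover have "summable (\<lambda>n. of_int \<lceil>real n * \<gamma>\<rceil> / 2 ^ n :: real)"
    using assms by (intro summable_ceil_sum) auto
  ultimately show ?thesis
    by (metis (no_types, lifting) sums_le summable_sums diff_numeral_special(11) one_add_one add_diff_cancel_right')
qed

lemma ceil_sum_le_2:
  assumes "0 \<le> \<gamma>" "\<gamma> \<le> 1"
  shows "ceil_sum \<gamma> \<le> 2"
proof -
  have "ceil_sum \<gamma> \<le> (\<Sum>n. real n / 2 ^ n)"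
    unfolding ceil_sum_def
    using abs_floor_ceil_le(2)[OF assms] sums_summable[OF sums_n_div_2_power]
    by (intro suminf_le summable_ceil_sum assms divide_right_mono) (auto intro: order_trans[OF abs_ge_self])
  then show ?thesis using sums_n_div_2_power by (simp add: sums_iff)
qed

text \<open>Summation by parts: turns a binary expansion into a sum over its partial digit sums.\<close>

lemma suminf_diff_div_2_power:
  fixes h :: "nat \<Rightarrow> real"
  assumes "summable (\<lambda>n. h n / 2 ^ n)"
  shows "(\<lambda>n. (h (Suc n) - h n) / 2 ^ Suc n) sums ((\<Sum>n. h n / 2 ^ n) / 2 - h 0)"
proof -
  let ?S = "\<Sum>n. h n / 2 ^ n"
  have "(\<lambda>n. h n / 2 ^ n) sums ?S" using assms by (rule summable_sums)
  then have 1: "(\<lambda>n. h (Suc n) / 2 ^ Suc n) sums (?S - h 0)"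
    by (subst sums_Suc_iff[of "\<lambda>n. h n / 2 ^ n"]) simp
  have "(\<lambda>n. h n / 2 ^ n * (1/2)) sums (?S * (1/2))"
    using assms by (intro sums_mult2 summable_sums)
  from sums_diff[OF 1 this] show ?thesis
    by (simp add: diff_divide_distrib mult.commute[of 2])
qed

subsection \<open>Rotation orbits avoid their hole\<close>

lemma avoiding_set_ne_iff:
  assumes "hole a b"
  shows "avoiding_set a b \<noteq> {0, 1} \<longleftrightarrow> (\<exists>x\<in>avoiding_set a b. 0 < x \<and> x < 1)"
proof -
  have "(doubling ^^ n) 0 = 0" "(doubling ^^ n) 1 = 1" for n
    by (induction n) (auto simp: doubling_def)
  then have "{0, 1} \<subseteq> avoiding_set a b"
    using assms by (auto simp: avoiding_set_def hole_def)
  moreover have "avoiding_set a b \<subseteq> {0..1}"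
    by (auto simp: avoiding_set_def)
  ultimately show ?thesis by fastforce
qed

lemma avoiding_set_invariant:
  assumes "x \<in> A" "A \<subseteq> {0..1} - {a<..<b}" "\<And>y. y \<in> A \<Longrightarrow> doubling y \<in> A"
  shows "x \<in> avoiding_set a b"
proof -
  have "(doubling ^^ n) x \<in> A" for n
    using assms by (induction n) auto
  then have "(doubling ^^ n) x \<in> {0..1} - {a<..<b}" for n
    using assms(2) by blast
  with assms show ?thesis by (auto simp: avoiding_set_def)
qed

text \<open>The doubling map acts on these points as the rotation \<open>\<theta> \<mapsto> \<theta> + \<gamma>\<close> modulo 1 on \<open>(-1, 0]\<close>:
  the binary digits of \<open>mechanical \<gamma> \<theta>\<close> are \<open>\<lceil>(n + 1)\<gamma> + \<theta>\<rceil> - \<lceil>n\<gamma> + \<theta>\<rceil>\<close>.\<close>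

definition mechanical :: "real \<Rightarrow> real \<Rightarrow> real" where
  "mechanical \<gamma> \<theta> = (\<Sum>n. of_int \<lceil>real n * \<gamma> + \<theta>\<rceil> / 2 ^ n) / 2"

context
  fixes \<gamma> :: real
  assumes \<gamma>: "0 < \<gamma>" "\<gamma> < 1"
begin

lemma summable_mechanical:
  assumes "-1 < \<theta>" "\<theta> \<le> 0"
  shows "summable (\<lambda>n. real_of_int \<lceil>real n * \<gamma> + \<theta>\<rceil> / 2 ^ n)"
proof (rule summable_linear_div_2_power)
  fix n
  have "0 \<le> real n * \<gamma>" "real n * \<gamma> \<le> real n"
    using \<gamma> by (auto simp: mult_left_le)
  then have "- 1 < real n * \<gamma> + \<theta>" "real n * \<gamma> + \<theta> \<le> of_int (int n)"
    using assms by auto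
  then have "- 1 < \<lceil>real n * \<gamma> + \<theta>\<rceil>" "\<lceil>real n * \<gamma> + \<theta>\<rceil> \<le> int n"
    by linarith+
  then show "\<bar>real_of_int \<lceil>real n * \<gamma> + \<theta>\<rceil>\<bar> \<le> real n + 1"
    by linarith
qed

text \<open>The term \<open>n = 0\<close> vanishes as \<open>\<lceil>\<theta>\<rceil> = 0\<close>.
  The phase \<open>\<gamma> + \<theta>\<close> is not reduced modulo 1; its sign decides the first
  digit.\<close>

lemma mechanical_shift:
  assumes "-1 < \<theta>" "\<theta> \<le> 0"
  shows "summable (\<lambda>n. real_of_int \<lceil>real n * \<gamma> + (\<gamma> + \<theta>)\<rceil> / 2 ^ n)"
    and "4 * mechanical \<gamma> \<theta> = (\<Sum>n. of_int \<lceil>real n * \<gamma> + (\<gamma> + \<theta>)\<rceil> / 2 ^ n)"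
proof -
  let ?f = "\<lambda>n. real_of_int \<lceil>real n * \<gamma> + \<theta>\<rceil> / 2 ^ n"
  have "\<lceil>\<theta>\<rceil> = 0" using assms by linarith
  then have "?f 0 = 0" by simp
  moreover have "?f sums (2 * mechanical \<gamma> \<theta>)"
    using summable_sums[OF summable_mechanical[OF assms]] by (simp add: mechanical_def)
  ultimately have "(\<lambda>n. ?f (Suc n)) sums (2 * mechanical \<gamma> \<theta>)"
    by (subst sums_Suc_iff[of ?f]) simp
  from sums_mult[OF this, of 2]
  have "(\<lambda>n. of_int \<lceil>real n * \<gamma> + (\<gamma> + \<theta>)\<rceil> / 2 ^ n) sums (4 * mechanical \<gamma> \<theta>)"
    by (simp add: algebra_simps)
  then show "summable (\<lambda>n. real_of_int \<lceil>real n * \<gamma> + (\<gamma> + \<theta>)\<rceil> / 2 ^ n)"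
    and "4 * mechanical \<gamma> \<theta> = (\<Sum>n. of_int \<lceil>real n * \<gamma> + (\<gamma> + \<theta>)\<rceil> / 2 ^ n)"
    by (auto simp: sums_iff)
qed

text \<open>The first digit is 0, and \<open>\<gamma> + \<theta> \<le> 0\<close> bounds each ceiling
  by \<open>\<lceil>n\<gamma>\<rceil>\<close>.\<close>

lemma mechanical_low:
  assumes "-1 < \<theta>" "\<theta> \<le> - \<gamma>"
  shows "mechanical \<gamma> (\<theta> + \<gamma>) = 2 * mechanical \<gamma> \<theta>"
    and "mechanical \<gamma> \<theta> \<le> ceil_sum \<gamma> / 4" "0 \<le> mechanical \<gamma> \<theta>"
proof -
  have \<theta>: "\<theta> \<le> 0" "\<gamma> + \<theta> \<le> 0" "- 1 < \<gamma> + \<theta>" using assms \<gamma> by auto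
  note sh = mechanical_shift[OF assms(1) \<theta>(1)]
  show "mechanical \<gamma> (\<theta> + \<gamma>) = 2 * mechanical \<gamma> \<theta>"
    unfolding add.commute[of \<theta>] mechanical_def[of _ "\<gamma> + \<theta>"] sh(2)[symmetric] by simp
  have "4 * mechanical \<gamma> \<theta> \<le> ceil_sum \<gamma>"
    unfolding sh(2) ceil_sum_def using \<theta> \<gamma>
    by (intro suminf_le sh(1) summable_ceil_sum divide_right_mono) (auto intro!: ceiling_mono)
  then show "mechanical \<gamma> \<theta> \<le> ceil_sum \<gamma> / 4" by simp
  have "real_of_int \<lceil>real n * \<gamma> + (\<gamma> + \<theta>)\<rceil> \<ge> 0" for n
  proof -
    have "0 \<le> real n * \<gamma>" using \<gamma> by simp
    then have "-1 < real n * \<gamma> + (\<gamma> + \<theta>)" using \<theta>(3) by linarith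
    then have "0 \<le> \<lceil>real n * \<gamma> + (\<gamma> + \<theta>)\<rceil>" by linarith
    then show ?thesis by simp
  qed
  then have "0 \<le> 4 * mechanical \<gamma> \<theta>"
    unfolding sh(2) by (intro suminf_nonneg sh(1)) auto
  then show "0 \<le> mechanical \<gamma> \<theta>" by simp
qed

text \<open>The first digit is 1: lowering the phase by 1 lowers the series by
  \<open>\<Sum> 1 / 2^n = 2\<close>, and \<open>\<gamma> + \<theta> > 0\<close> makes each ceiling
  exceed \<open>\<lfloor>n\<gamma>\<rfloor>\<close>.\<close>

lemma mechanical_high:
  assumes "- \<gamma> < \<theta>" "\<theta> \<le> 0"
  shows "mechanical \<gamma> (\<theta> + \<gamma> - 1) = 2 * mechanical \<gamma> \<theta> - 1"
    and "1 / 2 + floor_sum \<gamma> / 4 \<le> mechanical \<gamma> \<theta>" "mechanical \<gamma> \<theta> \<le> 1"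
proof -
  have \<theta>: "-1 < \<theta>" "0 < \<gamma> + \<theta>" "- 1 < \<theta> + \<gamma> - 1" "\<theta> + \<gamma> - 1 \<le> 0" using assms \<gamma> by auto
  note sh = mechanical_shift[OF \<theta>(1) assms(2)]
  have "(\<lambda>n. real_of_int \<lceil>real n * \<gamma> + (\<theta> + \<gamma> - 1)\<rceil> / 2 ^ n + 1 / 2 ^ n) sums (2 * mechanical \<gamma> (\<theta> + \<gamma> - 1) + 2)"
    using summable_sums[OF summable_mechanical[OF \<theta>(3,4)]] sums_1_div_2_power
    by (intro sums_add) (simp_all add: mechanical_def)
  moreover have "real_of_int \<lceil>real n * \<gamma> + (\<theta> + \<gamma> - 1)\<rceil> / 2 ^ n + 1 / 2 ^ n
      = real_of_int \<lceil>real n * \<gamma> + (\<gamma> + \<theta>)\<rceil> / 2 ^ n" for n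
  proof -
    have "\<lceil>real n * \<gamma> + (\<theta> + \<gamma> - 1)\<rceil> + 1 = \<lceil>real n * \<gamma> + (\<gamma> + \<theta>)\<rceil>"
      by linarith
    then show ?thesis by (simp add: add_divide_distrib[symmetric] flip: of_int_add)
  qed
  ultimately have "4 * mechanical \<gamma> \<theta> = 2 * mechanical \<gamma> (\<theta> + \<gamma> - 1) + 2"
    using sh(2) by (simp add: sums_iff)
  then show "mechanical \<gamma> (\<theta> + \<gamma> - 1) = 2 * mechanical \<gamma> \<theta> - 1"
    by simp
  have s: "(\<lambda>n. real_of_int \<lfloor>real n * \<gamma>\<rfloor> / 2 ^ n + 1 / 2 ^ n) sums (floor_sum \<gamma> + 2)"
    unfolding floor_sum_def using \<gamma>
    by (intro sums_add summable_sums summable_floor_sum sums_1_div_2_power) auto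
  have le: "real_of_int \<lfloor>real n * \<gamma>\<rfloor> + 1 \<le> real_of_int \<lceil>real n * \<gamma> + (\<gamma> + \<theta>)\<rceil>" for n
  proof -
    have "real_of_int \<lfloor>real n * \<gamma>\<rfloor> < real_of_int \<lceil>real n * \<gamma> + (\<gamma> + \<theta>)\<rceil>"
      using \<theta>(2) of_int_floor_le[of "real n * \<gamma>"] le_of_int_ceiling[of "real n * \<gamma> + (\<gamma> + \<theta>)"]
      by linarith
    then have "\<lfloor>real n * \<gamma>\<rfloor> + 1 \<le> \<lceil>real n * \<gamma> + (\<gamma> + \<theta>)\<rceil>" by simp
    then show ?thesis by linarith
  qed
  have "floor_sum \<gamma> + 2 \<le> 4 * mechanical \<gamma> \<theta>"
    unfolding sh(2) sums_unique[OF s] using le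
    by (intro suminf_le sh(1) sums_summable[OF s])
       (auto simp: add_divide_distrib[symmetric] divide_right_mono)
  then show "1 / 2 + floor_sum \<gamma> / 4 \<le> mechanical \<gamma> \<theta>" by simp
  have s2: "(\<lambda>n. real n / 2 ^ n + 1 / 2 ^ n) sums (2 + 2 :: real)"
    by (intro sums_add sums_n_div_2_power sums_1_div_2_power)
  have le2: "real_of_int \<lceil>real n * \<gamma> + (\<gamma> + \<theta>)\<rceil> \<le> real n + 1" for n
  proof -
    have "real n * \<gamma> \<le> real n" using \<gamma> by (auto simp: mult_left_le)
    then have "real n * \<gamma> + (\<gamma> + \<theta>) \<le> of_int (int n + 1)" using \<gamma> assms by simp
    then have "\<lceil>real n * \<gamma> + (\<gamma> + \<theta>)\<rceil> \<le> int n + 1" by linarith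
    then show ?thesis by linarith
  qed
  have "4 * mechanical \<gamma> \<theta> \<le> 2 + 2"
    unfolding sh(2) sums_unique[OF s2] using le2
    by (intro suminf_le sh(1) sums_summable[OF s2])
       (auto simp: add_divide_distrib[symmetric] divide_right_mono)
  then show "mechanical \<gamma> \<theta> \<le> 1" by simp
qed

text \<open>The mechanical points form a forward-invariant set, with the phases up to
  \<open>-\<gamma>\<close> landing in \<open>[0, a]\<close> and the others in
  \<open>[b, 1]\<close>.\<close>

lemma mechanical_avoids:
  assumes "a \<ge> ceil_sum \<gamma> / 4" "b \<le> 1 / 2 + floor_sum \<gamma> / 4" "hole a b"
  shows "avoiding_set a b \<noteq> {0, 1}"
proof -
  let ?A = "mechanical \<gamma> ` {-1<..0}"
  have cs: "1 \<le> ceil_sum \<gamma>" "ceil_sum \<gamma> \<le> 2" "0 < floor_sum \<gamma>"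
    using ceil_sum_ge_1 ceil_sum_le_2 floor_sum_pos \<gamma> by auto
  \<comment> \<open>The phase \<open>-\<gamma>\<close> yields \<open>L \<gamma>\<close> itself, an
    interior point of the unit interval.\<close>
  have "mechanical \<gamma> (-\<gamma>) = ceil_sum \<gamma> / 4"
    using mechanical_shift(2)[of "-\<gamma>"] \<gamma> by (simp add: ceil_sum_def)
  then have x: "0 < mechanical \<gamma> (-\<gamma>)" "mechanical \<gamma> (-\<gamma>) < 1" using cs by auto
  have low: "mechanical \<gamma> \<theta> \<in> {0..a} \<and> mechanical \<gamma> \<theta> \<le> 1/2" if "-1 < \<theta>" "\<theta> \<le> -\<gamma>" for \<theta>
    using mechanical_low[OF that] assms(1) cs by auto
  have high: "mechanical \<gamma> \<theta> \<in> {b..1} \<and> mechanical \<gamma> \<theta> > 1/2" if "-\<gamma> < \<theta>" "\<theta> \<le> 0" for \<theta>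
    using mechanical_high[OF that] assms(2) cs by auto
  have "mechanical \<gamma> (-\<gamma>) \<in> avoiding_set a b"
  proof (rule avoiding_set_invariant)
    show "mechanical \<gamma> (-\<gamma>) \<in> ?A" using \<gamma> by auto
    have "mechanical \<gamma> \<theta> \<in> {0..1} - {a<..<b}" if "-1 < \<theta>" "\<theta> \<le> 0" for \<theta>
      using low[of \<theta>] high[of \<theta>] that assms(3) by (cases "\<theta> \<le> -\<gamma>") (auto simp: hole_def)
    then show "?A \<subseteq> {0..1} - {a<..<b}" by auto
    have "doubling (mechanical \<gamma> \<theta>) \<in> ?A" if "-1 < \<theta>" "\<theta> \<le> 0" for \<theta>
    proof (cases "\<theta> \<le> -\<gamma>")
      case True
      then have "doubling (mechanical \<gamma> \<theta>) = mechanical \<gamma> (\<theta> + \<gamma>)"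
        using mechanical_low(1)[of \<theta>] low[of \<theta>] that by (simp add: doubling_def)
      with True \<gamma> that show ?thesis by auto
    next
      case False
      then have "doubling (mechanical \<gamma> \<theta>) = mechanical \<gamma> (\<theta> + \<gamma> - 1)"
        using mechanical_high(1)[of \<theta>] high[of \<theta>] that by (simp add: doubling_def)
      with False \<gamma> that show ?thesis by auto
    qed
    then show "\<And>y. y \<in> ?A \<Longrightarrow> doubling y \<in> ?A" by auto
  qed
  with x show ?thesis using avoiding_set_ne_iff[OF assms(3)] by blast
qed

end

subsection \<open>Density of the plateaus\<close>

text \<open>Tannery's theorem. The terms are assumed eventually constant because
  \<open>\<lfloor>n x\<rfloor>\<close> is constant on small one-sided neighbourhoods.\<close>

lemma tendsto_suminf_div_2_power:
  fixes h :: "nat \<Rightarrow> real \<Rightarrow> real"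
  assumes "F \<noteq> bot"
    and lim: "\<And>n. \<forall>\<^sub>F x in F. h n x = l n"
    and bound: "\<forall>\<^sub>F x in F. \<forall>n. \<bar>h n x\<bar> \<le> real n"
  shows "((\<lambda>x. \<Sum>n. h n x / 2 ^ n) \<longlongrightarrow> (\<Sum>n. l n / 2 ^ n)) F"
proof -
  have "((\<lambda>x. h n x / 2 ^ n) \<longlongrightarrow> l n / 2 ^ n) F" for n
    by (rule tendsto_eventually) (use lim[of n] in eventually_elim, simp)
  moreover have "\<forall>\<^sub>F (n, x) in at_top \<times>\<^sub>F F. norm (h n x / 2 ^ n) \<le> real n / 2 ^ n"
    using bound unfolding eventually_prod_filter
    by (intro exI[of _ "\<lambda>_. True"] exI[of _ "\<lambda>x. \<forall>n. \<bar>h n x\<bar> \<le> real n"])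
       (auto simp: divide_right_mono)
  moreover have "summable (\<lambda>n. real n / 2 ^ n :: real)"
    using sums_n_div_2_power by (rule sums_summable)
  ultimately show ?thesis
    using tannerys_theorem[of "\<lambda>n x. h n x / 2 ^ n" "\<lambda>n. l n / 2 ^ n" F "\<lambda>n. real n / 2 ^ n"] assms(1)
    by blast
qed

lemma floor_sum_tendsto_right:
  assumes "0 \<le> \<rho>" "\<rho> < 1"
  shows "(floor_sum \<longlongrightarrow> floor_sum \<rho>) (at_right \<rho>)"
  unfolding floor_sum_def
proof (rule tendsto_suminf_div_2_power)
  show "\<forall>\<^sub>F x in at_right \<rho>. \<forall>n. \<bar>real_of_int \<lfloor>real n * x\<rfloor>\<bar> \<le> real n"
    using eventually_at_right_real[OF assms(2)]
  proof eventually_elim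
    case (elim x)
    with assms abs_floor_ceil_le(1)[of x] show ?case by auto
  qed
  show "\<forall>\<^sub>F x in at_right \<rho>. real_of_int \<lfloor>real n * x\<rfloor> = real_of_int \<lfloor>real n * \<rho>\<rfloor>" for n
  proof (cases "n = 0")
    case False
    then have "\<rho> < (of_int \<lfloor>real n * \<rho>\<rfloor> + 1) / real n"
      using floor_correct[of "real n * \<rho>"] by (simp add: field_simps)
    from eventually_at_right_real[OF this] show ?thesis
    proof eventually_elim
      case (elim x)
      then have "real n * \<rho> \<le> real n * x" "real n * x < of_int \<lfloor>real n * \<rho>\<rfloor> + 1"
        using False by (auto simp: field_simps)
      then have "\<lfloor>real n * x\<rfloor> = \<lfloor>real n * \<rho>\<rfloor>"
        by linarith
      then show ?case by simp
    qed
  qed simp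
qed simp

text \<open>Just left of \<open>\<rho>\<close> the floor of \<open>n x\<close> is
  \<open>\<lceil>n\<rho>\<rceil> - 1\<close>, except for \<open>n = 0\<close>, where it stays 0; the
  lost units add up to \<open>\<Sum> 1 / 2^n = 1\<close> over \<open>n > 0\<close>.\<close>

lemma floor_sum_tendsto_left:
  assumes "0 < \<rho>" "\<rho> \<le> 1"
  shows "(floor_sum \<longlongrightarrow> ceil_sum \<rho> - 1) (at_left \<rho>)"
proof -
  let ?l = "\<lambda>n. if n = 0 then 0 else real_of_int \<lceil>real n * \<rho>\<rceil> - 1"
  have "((\<lambda>x. \<Sum>n. of_int \<lfloor>real n * x\<rfloor> / 2 ^ n) \<longlongrightarrow> (\<Sum>n. ?l n / 2 ^ n)) (at_left \<rho>)"
  proof (rule tendsto_suminf_div_2_power)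
    show "\<forall>\<^sub>F x in at_left \<rho>. \<forall>n. \<bar>real_of_int \<lfloor>real n * x\<rfloor>\<bar> \<le> real n"
      using eventually_at_left_real[OF assms(1)]
    proof eventually_elim
      case (elim x)
      with assms abs_floor_ceil_le(1)[of x] show ?case by auto
    qed
    show "\<forall>\<^sub>F x in at_left \<rho>. real_of_int \<lfloor>real n * x\<rfloor> = ?l n" for n
    proof (cases "n = 0")
      case False
      then have "(of_int \<lceil>real n * \<rho>\<rceil> - 1) / real n < \<rho>"
        using ceiling_correct[of "real n * \<rho>"] by (simp add: field_simps)
      from eventually_at_left_real[OF this] show ?thesis
      proof eventually_elim
        case (elim x)
        then have 1: "real n * x < real n * \<rho>" "of_int \<lceil>real n * \<rho>\<rceil> - 1 < real n * x"
          using False by (auto simp: field_simps)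
        then have "\<lfloor>real n * x\<rfloor> = \<lceil>real n * \<rho>\<rceil> - 1"
          using le_of_int_ceiling[of "real n * \<rho>"] by (intro floor_unique) (simp, linarith)
        then show ?case using False by simp
      qed
    qed simp
  qed simp
  moreover have "(\<lambda>n. real_of_int \<lceil>real n * \<rho>\<rceil> / 2 ^ n - (1 / 2 ^ n - (if n = 0 then 1 else 0)))
      sums (ceil_sum \<rho> - (2 - 1))"
    using assms sums_single[of 0 "\<lambda>_. 1::real"] unfolding ceil_sum_def
    by (intro sums_diff sums_1_div_2_power summable_sums summable_ceil_sum) auto
  moreover have "?l n / 2 ^ n = real_of_int \<lceil>real n * \<rho>\<rceil> / 2 ^ n - (1 / 2 ^ n - (if n = 0 then 1 else 0))" for n
    by (simp add: diff_divide_distrib)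
  ultimately show ?thesis
    by (simp add: floor_sum_def[abs_def] sums_iff)
qed

text \<open>An intermediate value argument for an increasing function with jumps: at the supremum
  \<open>\<rho>\<close> of the slopes with \<open>floor_sum\<close> below \<open>e\<close>, the
  function passes from \<open>ceil_sum \<rho> - 1\<close> to \<open>floor_sum \<rho>\<close>, and
  \<open>e\<close> lies in between.\<close>

lemma ex_between_ceil_floor_sum:
  assumes "0 < e" "e < 1"
  shows "\<exists>\<gamma>. 0 < \<gamma> \<and> \<gamma> < 1 \<and> ceil_sum \<gamma> - 1 \<le> e \<and> e \<le> floor_sum \<gamma>"
proof -
  define X where "X = {\<gamma>. 0 \<le> \<gamma> \<and> \<gamma> \<le> 1 \<and> floor_sum \<gamma> < e}"
  define \<rho> where "\<rho> = Sup X"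
  have X0: "0 \<in> X" using assms by (simp add: X_def floor_sum_0)
  have bdd: "bdd_above X" by (auto simp: X_def)
  have \<rho>01: "0 \<le> \<rho>" "\<rho> \<le> 1"
    using X0 bdd by (auto simp: \<rho>_def X_def intro: cSup_upper intro!: cSup_least)
  have left: "ceil_sum \<rho> - 1 \<le> e" if "0 < \<rho>"
  proof (rule tendsto_upperbound[OF floor_sum_tendsto_left])
    show "\<forall>\<^sub>F x in at_left \<rho>. floor_sum x \<le> e"
      using eventually_at_left_real[OF that]
    proof eventually_elim
      case (elim x)
      then obtain y where "y \<in> X" "x < y"
        using X0 bdd less_cSup_iff[of X x] by (auto simp: \<rho>_def)
      then have "floor_sum x \<le> floor_sum y" "floor_sum y < e"
        using elim by (auto simp: X_def intro!: floor_sum_mono)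
      then show ?case by simp
    qed
  qed (use that \<rho>01 in auto)
  have right: "e \<le> floor_sum \<rho>" if "\<rho> < 1"
  proof (rule tendsto_lowerbound[OF floor_sum_tendsto_right])
    show "\<forall>\<^sub>F x in at_right \<rho>. e \<le> floor_sum x"
      using eventually_at_right_real[OF that]
    proof eventually_elim
      case (elim x)
      then have "x \<notin> X" using bdd cSup_upper[of x X] by (auto simp: \<rho>_def)
      with elim \<rho>01 show ?case by (auto simp: X_def)
    qed
  qed (use that \<rho>01 in auto)
  \<comment> \<open>The end slopes are excluded by \<open>floor_sum 0 = 0 < e\<close> and
    \<open>ceil_sum 1 - 1 = 1 > e\<close>.\<close>
  have "\<rho> \<noteq> 0" using right assms by (auto simp: floor_sum_0)
  moreover have "\<rho> \<noteq> 1" using left assms by (auto simp: ceil_sum_1)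
  ultimately show ?thesis using left right \<rho>01 by (intro exI[of _ \<rho>]) auto
qed

text \<open>Taking \<open>e = 4 * a - 1\<close> yields a slope with
  \<open>L \<gamma> \<le> a \<le> U \<gamma> - 1/4\<close>, hence also
  \<open>b \<le> U \<gamma>\<close>.\<close>

lemma avoiding_set_ne_if_short:
  assumes "hole a b" "1 / 4 < a" "a < 1 / 2" "b - a \<le> 1 / 4"
  shows "avoiding_set a b \<noteq> {0, 1}"
proof -
  obtain \<gamma> where \<gamma>: "0 < \<gamma>" "\<gamma> < 1" "ceil_sum \<gamma> - 1 \<le> 4 * a - 1" "4 * a - 1 \<le> floor_sum \<gamma>"
    using ex_between_ceil_floor_sum[of "4 * a - 1"] assms by auto
  with assms show ?thesis by (intro mechanical_avoids[of \<gamma>]) auto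
qed

subsection \<open>Orbits confined to a half circle\<close>

definition ones :: "(nat \<Rightarrow> int) \<Rightarrow> nat \<Rightarrow> nat \<Rightarrow> int" where
  "ones w n m = (\<Sum>i<m. w (n + i))"

lemma ones_0 [simp]: "ones w n 0 = 0"
  by (simp add: ones_def)

lemma ones_Suc: "ones w n (Suc m) = ones w n m + w (n + m)"
  by (simp add: ones_def)

lemma ones_add: "ones w n (k + m) = ones w n k + ones w (n + k) m"
  by (induction m) (auto simp: ones_Suc ones_def add.assoc)

lemma ones_complement: "ones (\<lambda>n. 1 - w n) n m = int m - ones w n m"
  by (simp add: ones_def sum_subtractf)

lemma ones_bounds:
  assumes "\<And>n. w n \<in> {0, 1}"
  shows "0 \<le> ones w n m" "ones w n m \<le> int m"
proof -
  have "0 \<le> w k \<and> w k \<le> 1" for k using assms[of k] by auto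
  then show "0 \<le> ones w n m" "ones w n m \<le> int m"
    using sum_mono[of "{..<m}" "\<lambda>i. w (n + i)" "\<lambda>_. 1"] by (auto simp: ones_def intro: sum_nonneg)
qed

lemma orbit_expansion:
  fixes y :: "nat \<Rightarrow> real"
  assumes "\<And>n. y (Suc n) = 2 * y n - of_int (w n)"
  shows "y n = (\<Sum>i<m. of_int (w (n + i)) / 2 ^ Suc i) + y (n + m) / 2 ^ m"
proof (induction m)
  case (Suc m)
  have "y (n + m) / 2 ^ m = of_int (w (n + m)) / 2 ^ Suc m + y (n + Suc m) / 2 ^ Suc m"
    by (simp add: assms field_simps)
  with Suc show ?case by simp
qed simp

text \<open>The digits \<open>w\<close> expand \<open>y\<close> in binary, and summation by parts
  rewrites this through prefix counts, which can be compared termwise with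
  \<open>ceil_sum\<close>.\<close>

lemma orbit_sums:
  fixes y :: "nat \<Rightarrow> real"
  assumes y: "\<And>n. y (Suc n) = 2 * y n - of_int (w n)" and w: "\<And>n. w n \<in> {0, 1}"
    and bounded: "\<And>n. \<bar>y n\<bar> \<le> 1"
  shows "(\<lambda>m. of_int (ones w n m) / 2 ^ m) sums (2 * y n)"
proof -
  have "(\<lambda>m. y (n + m) / 2 ^ m) \<longlonglongrightarrow> 0"
  proof (rule Lim_null_comparison)
    show "\<forall>\<^sub>F m in sequentially. norm (y (n + m) / 2 ^ m) \<le> (1/2) ^ m"
      using bounded by (intro always_eventually allI) (simp add: power_one_over divide_right_mono)
    show "(\<lambda>m. (1/2) ^ m :: real) \<longlonglongrightarrow> 0" by (simp add: LIMSEQ_power_zero)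
  qed
  then have *: "(\<lambda>m. y n - y (n + m) / 2 ^ m) \<longlonglongrightarrow> y n"
    using tendsto_diff[OF tendsto_const] by force
  have 1: "(\<lambda>i. of_int (w (n + i)) / 2 ^ Suc i) sums y n"
  proof -
    have "(\<Sum>i<m. of_int (w (n + i)) / 2 ^ Suc i) = y n - y (n + m) / 2 ^ m" for m
      using orbit_expansion[of y w n m, OF y] by simp
    with * show ?thesis by (simp add: sums_def)
  qed
  have s: "summable (\<lambda>m. real_of_int (ones w n m) / 2 ^ m)"
    using ones_bounds[of w n, OF w]
    by (intro summable_linear_div_2_power) (smt (verit) of_int_0_le_iff of_int_le_iff of_int_of_nat_eq)
  from suminf_diff_div_2_power[OF this]
  have "(\<lambda>i. of_int (w (n + i)) / 2 ^ Suc i) sums ((\<Sum>m. real_of_int (ones w n m) / 2 ^ m) / 2)"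
    by (simp add: ones_Suc)
  with 1 have "(\<Sum>m. real_of_int (ones w n m) / 2 ^ m) / 2 = y n"
    by (rule sums_unique2[symmetric])
  with s show ?thesis by (simp add: sums_iff)
qed

text \<open>In a shortest violation the two factors can differ only in their first and last letters, so
  they are \<open>1p1\<close> and \<open>0p0\<close>; the corresponding points are then at least \<open>1/2\<close> apart.\<close>

lemma ones_balanced:
  fixes y :: "nat \<Rightarrow> real"
  assumes y: "\<And>n. y (Suc n) = 2 * y n - of_int (w n)" and w: "\<And>n. w n \<in> {0, 1}"
    and range: "\<And>n. 0 \<le> y n \<and> y n \<le> 1" and close: "\<And>n k. y n - y k < 1 / 2"
  shows "ones w n m - ones w k m \<le> 1"
proof (rule ccontr)
  assume violation: "\<not> ?thesis"
  define P where "P m \<longleftrightarrow> (\<exists>n k. 2 \<le> ones w n m - ones w k m)" for m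
  define l where "l = (LEAST m. P m)"
  have "P m" unfolding P_def using violation by (intro exI[of _ n] exI[of _ k]) simp
  then have "P l" unfolding l_def by (rule LeastI)
  then obtain n k where nk: "2 \<le> ones w n l - ones w k l" by (auto simp: P_def)
  have least: "ones w n' m' - ones w k' m' \<le> 1" if "m' < l" for n' k' m'
  proof -
    have "\<not> P m'" using that not_less_Least unfolding l_def by blast
    then have "\<not> 2 \<le> ones w n' m' - ones w k' m'" unfolding P_def by blast
    then show ?thesis by linarith
  qed
  define d where "d j = ones w n j - ones w k j" for j
  have "l \<noteq> 0" using nk by (intro notI) simp
  then obtain l' where l': "l = Suc l'" by (cases l) auto
  have d0: "d 0 = 0" by (simp add: d_def)
  have wb: "0 \<le> w i \<and> w i \<le> 1" for i using w[of i] by auto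
  have dl: "d l = 2"
    using nk least[of l' n k] wb[of "n + l'"] wb[of "k + l'"] by (simp add: d_def l' ones_Suc)
  \<comment> \<open>The prefix of length \<open>j\<close> and the remaining suffix are both shorter
    than \<open>l\<close>, so each contributes at most 1 to the total difference 2.\<close>
  have d1: "d j = 1" if "0 < j" "j < l" for j
  proof -
    have "d l = d j + (ones w (n + j) (l - j) - ones w (k + j) (l - j))"
      using ones_add[of w n j "l - j"] ones_add[of w k j "l - j"] that by (simp add: d_def)
    with least[of "l - j" "n + j" "k + j"] least[of j n k] dl that show ?thesis
      by (simp add: d_def)
  qed
  have dS: "d (Suc j) - d j = w (n + j) - w (k + j)" for j
    by (simp add: d_def ones_Suc)
  have "l' \<noteq> 0"
    using dl dS[of 0] d0 wb[of n] wb[of k] by (intro notI) (simp add: l')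
  then have "y n - y k
      = (\<Sum>i<l. of_int (d (Suc i) - d i) / 2 ^ Suc i) + (y (n + l) - y (k + l)) / 2 ^ l"
    using orbit_expansion[of y w n, OF y, of l] orbit_expansion[of y w k, OF y, of l]
    by (simp add: dS sum_subtractf diff_divide_distrib)
  \<comment> \<open>Only the first and last increments of \<open>d\<close> are nonzero, and both
    equal 1. The remaining tail subtracts at most \<open>1 / 2^l\<close>, which leaves at least
    \<open>1/2\<close>.\<close>
  moreover have "(\<Sum>i<l. of_int (d (Suc i) - d i) / 2 ^ Suc i) = (1 / 2 + 1 / 2 ^ l :: real)"
  proof -
    have "(\<Sum>i<l. of_int (d (Suc i) - d i) / 2 ^ Suc i :: real)
        = (\<Sum>i\<in>{0, l'}. of_int (d (Suc i) - d i) / 2 ^ Suc i)"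
      by (rule sum.mono_neutral_right) (auto simp: l' d1)
    also have "\<dots> = 1 / 2 + 1 / 2 ^ l"
      using \<open>l' \<noteq> 0\<close> d0 d1[of l'] d1[of 1] dl by (simp add: l')
    finally show ?thesis .
  qed
  moreover have "- 1 / 2 ^ l \<le> (y (n + l) - y (k + l)) / 2 ^ l"
    using range[of "n + l"] range[of "k + l"] by (intro divide_right_mono) auto
  ultimately show False using close[of n k] by simp
qed

section \<open>Rotation number and extremal positions\<close>

text \<open>Cutting a block of length \<open>k * m\<close> into pieces of either length gives
  \<open>(ones w n m - 1) / m \<le> (ones w n k + 1) / k\<close>; the supremum of the left sides is
  the slope.\<close>

lemma ex_rotation_number:
  assumes balanced: "\<And>n k m. ones w n m - ones w k m \<le> 1"
  shows "\<exists>\<gamma>. \<forall>m. \<bar>of_int (ones w n m) - real m * \<gamma>\<bar> \<le> 1"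
proof -
  have low: "int k * (ones w n m - 1) \<le> ones w n (k * m)" for k m
  proof (induction k)
    case (Suc k)
    have "ones w n (Suc k * m) = ones w n (k * m) + ones w (n + k * m) m"
      using ones_add[of w n "k * m" m] by (simp add: add.commute)
    with Suc balanced[of n m "n + k * m"] show ?case by (simp add: algebra_simps)
  qed simp
  have high: "ones w n (k * m) \<le> int k * (ones w n m + 1)" for k m
  proof (induction k)
    case (Suc k)
    have "ones w n (Suc k * m) = ones w n (k * m) + ones w (n + k * m) m"
      using ones_add[of w n "k * m" m] by (simp add: add.commute)
    with Suc balanced[of "n + k * m" m n] show ?case by (simp add: algebra_simps)
  qed simp
  let ?f = "\<lambda>m. (real_of_int (ones w n m) - 1) / real m"
  let ?g = "\<lambda>m. (real_of_int (ones w n m) + 1) / real m"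
  have fg: "?f m \<le> ?g k" if "0 < m" "0 < k" for m k
  proof -
    have "int k * (ones w n m - 1) \<le> int m * (ones w n k + 1)"
      using low[of k m] high[of m k] by (simp add: mult.commute)
    then have "real_of_int (int k * (ones w n m - 1)) \<le> real_of_int (int m * (ones w n k + 1))"
      by (simp only: of_int_le_iff)
    with that show ?thesis by (simp add: field_simps)
  qed
  define \<gamma> where "\<gamma> = (SUP m\<in>{0<..}. ?f m)"
  have bdd: "bdd_above (?f ` {0<..})"
    using fg[of _ 1] by (intro bdd_aboveI2[of _ _ "?g 1"]) auto
  have "\<bar>of_int (ones w n m) - real m * \<gamma>\<bar> \<le> 1" for m
  proof (cases "m = 0")
    case False
    have "?f m \<le> \<gamma>" unfolding \<gamma>_def using bdd False by (intro cSUP_upper) auto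
    moreover have "\<gamma> \<le> ?g m" unfolding \<gamma>_def using False fg by (intro cSUP_least) auto
    ultimately show ?thesis using False by (simp add: field_simps abs_le_iff)
  qed simp
  then show ?thesis by blast
qed

text \<open>A position where \<open>ones w 0 k - k * \<gamma>\<close> is minimal over a long window starts a
  factor all of whose prefixes have at least the average number of ones.\<close>

lemma ex_heavy_window:
  assumes "\<And>m. real_of_int (ones w 0 m) - real m * \<gamma> \<ge> - B"
  shows "\<exists>k. \<forall>j\<le>M. real j * \<gamma> \<le> of_int (ones w k j)"
proof (rule ccontr)
  assume "\<not> ?thesis"
  then have "\<forall>k. \<exists>j. j \<le> M \<and> of_int (ones w k j) < real j * \<gamma>" by (auto simp: not_le)
  then obtain j where j: "\<And>k. j k \<le> M" "\<And>k. of_int (ones w k (j k)) < real (j k) * \<gamma>" by metis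
  \<comment> \<open>An integer count below \<open>i * \<gamma>\<close> is at most
    \<open>\<lceil>i * \<gamma>\<rceil> - 1\<close>, so among the finitely many window lengths the
    deficit of a light window is at least \<open>\<delta>\<close>.\<close>
  define \<delta> where "\<delta> = Min ((\<lambda>i. real i * \<gamma> - (of_int \<lceil>real i * \<gamma>\<rceil> - 1)) ` {..M})"
  have "\<delta> \<in> (\<lambda>i. real i * \<gamma> - (of_int \<lceil>real i * \<gamma>\<rceil> - 1)) ` {..M}"
    unfolding \<delta>_def by (rule Min_in) auto
  moreover have "0 < real i * \<gamma> - (of_int \<lceil>real i * \<gamma>\<rceil> - 1)" for i
    using ceiling_correct[of "real i * \<gamma>"] by linarith
  ultimately have "0 < \<delta>" by auto
  have drop: "of_int (ones w k (j k)) - real (j k) * \<gamma> \<le> - \<delta>" for k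
  proof -
    have "\<delta> \<le> real (j k) * \<gamma> - (of_int \<lceil>real (j k) * \<gamma>\<rceil> - 1)"
      unfolding \<delta>_def using j(1)[of k] by (intro Min_le) auto
    moreover have "ones w k (j k) \<le> \<lceil>real (j k) * \<gamma>\<rceil> - 1"
      using j(2)[of k] by linarith
    ultimately show ?thesis by linarith
  qed
  \<comment> \<open>Concatenating \<open>t\<close> light windows pushes the discrepancy to
    \<open>- t * \<delta>\<close>, eventually below \<open>- B\<close>.\<close>
  have "\<exists>k. of_int (ones w 0 k) - real k * \<gamma> \<le> - real t * \<delta>" for t
  proof (induction t)
    case 0
    show ?case by (intro exI[of _ 0]) simp
  next
    case (Suc t)
    then obtain k where "of_int (ones w 0 k) - real k * \<gamma> \<le> - real t * \<delta>" by blast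
    with drop[of k] show ?case
      by (intro exI[of _ "k + j k"]) (simp add: ones_add algebra_simps)
  qed
  moreover obtain t where "B < real t * \<delta>"
    using reals_Archimedean3[OF \<open>0 < \<delta>\<close>] by blast
  ultimately show False
    by (smt (verit) assms mult_minus_left)
qed

text \<open>At the start of a heavy window the integer prefix counts dominate
  \<open>\<lceil>n\<gamma>\<rceil>\<close>. That start depends on the window length
  \<open>M\<close>, so only partial sums are compared with an orbit point.\<close>

lemma ceil_sum_le_orbit_bound:
  fixes y :: "nat \<Rightarrow> real"
  assumes y: "\<And>n. y (Suc n) = 2 * y n - of_int (w n)" and w: "\<And>n. w n \<in> {0, 1}"
    and range: "\<And>n. 0 \<le> y n \<and> y n \<le> c" "c \<le> 1"
    and \<gamma>: "0 \<le> \<gamma>" "\<gamma> \<le> 1" "\<And>m. real_of_int (ones w 0 m) - real m * \<gamma> \<ge> - B"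
  shows "ceil_sum \<gamma> \<le> 2 * c"
  unfolding ceil_sum_def
proof (rule suminf_le_const)
  show "summable (\<lambda>n. real_of_int \<lceil>real n * \<gamma>\<rceil> / 2 ^ n)"
    using \<gamma> by (intro summable_ceil_sum)
  fix M
  obtain k where k: "\<And>j. j \<le> M \<Longrightarrow> real j * \<gamma> \<le> of_int (ones w k j)"
    using ex_heavy_window[where w = w and M = M, OF \<gamma>(3)] by auto
  have s: "(\<lambda>m. of_int (ones w k m) / 2 ^ m) sums (2 * y k)"
    using range by (intro orbit_sums y w) (smt (verit))
  have "(\<Sum>n<M. real_of_int \<lceil>real n * \<gamma>\<rceil> / 2 ^ n) \<le> (\<Sum>n<M. of_int (ones w k n) / 2 ^ n)"
    using k by (intro sum_mono divide_right_mono) (auto simp: ceiling_le_iff)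
  also have "\<dots> \<le> 2 * y k"
    unfolding sums_unique[OF s] using ones_bounds[of w, OF w]
    by (intro sum_le_suminf sums_summable[OF s]) auto
  also have "\<dots> \<le> 2 * c" using range by simp
  finally show "(\<Sum>n<M. real_of_int \<lceil>real n * \<gamma>\<rceil> / 2 ^ n) \<le> 2 * c" .
qed

text \<open>A range shorter than \<open>1/2\<close> gives balance and hence a slope. The bound by
  \<open>d\<close> comes from the orbit itself, the one by \<open>c\<close> from the reflected orbit
  \<open>1 - y\<close> of slope \<open>1 - \<gamma>\<close>.\<close>

lemma rotation_number_of_confined_orbit:
  fixes y :: "nat \<Rightarrow> real"
  assumes y: "\<And>n. y (Suc n) = 2 * y n - of_int (w n)" and w: "\<And>n. w n \<in> {0, 1}"
    and range: "\<And>n. c \<le> y n \<and> y n \<le> d" "0 \<le> c" "d \<le> 1" "d - c < 1 / 2"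
  shows "\<exists>\<gamma>. 0 \<le> \<gamma> \<and> \<gamma> \<le> 1 \<and> ceil_sum \<gamma> \<le> 2 * d \<and> 2 * c \<le> floor_sum \<gamma>"
proof -
  have range': "0 \<le> y n \<and> y n \<le> 1" for n using range by (smt (verit))
  have "ones w n m - ones w k m \<le> 1" for n k m
    using range by (intro ones_balanced[where y = y] y w range') (smt (verit))
  from ex_rotation_number[of w 0, OF this]
  obtain \<gamma> where \<gamma>: "\<And>m. \<bar>of_int (ones w 0 m) - real m * \<gamma>\<bar> \<le> 1" by blast
  \<comment> \<open>The counts lie between 0 and \<open>m\<close>, so a slope outside
    \<open>[0, 1]\<close> would make the discrepancy unbounded.\<close>
  have "0 \<le> \<gamma>"
  proof (rule ccontr)
    assume "\<not> ?thesis"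
    then have "0 < - \<gamma>" by simp
    then obtain m where "1 < real m * (-\<gamma>)" using reals_Archimedean3 by blast
    moreover have "0 \<le> real_of_int (ones w 0 m)" using ones_bounds[of w 0 m, OF w] by simp
    ultimately show False using \<gamma>[of m] by simp
  qed
  moreover have "\<gamma> \<le> 1"
  proof (rule ccontr)
    assume "\<not> ?thesis"
    then obtain m where "1 < real m * (\<gamma> - 1)" using reals_Archimedean3[of "\<gamma> - 1"] by auto
    moreover have "real_of_int (ones w 0 m) \<le> real m" using ones_bounds[of w 0 m, OF w] by linarith
    ultimately show False using \<gamma>[of m] by (simp add: algebra_simps)
  qed
  moreover have "ceil_sum \<gamma> \<le> 2 * d"
    using range' range calculation
    by (intro ceil_sum_le_orbit_bound[where y = y and w = w and B = 1] y w)
       (auto intro: order_trans[OF _ \<gamma>] simp: abs_le_iff, smt (verit) \<gamma>)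
  moreover have "ceil_sum (1 - \<gamma>) \<le> 2 * (1 - c)"
  proof (rule ceil_sum_le_orbit_bound[where y = "\<lambda>n. 1 - y n" and w = "\<lambda>n. 1 - w n" and B = 1])
    show "1 - w n \<in> {0, 1}" for n using w[of n] by auto
    show "- 1 \<le> real_of_int (ones (\<lambda>n. 1 - w n) 0 m) - real m * (1 - \<gamma>)" for m
      using \<gamma>[of m] by (simp add: ones_complement algebra_simps abs_le_iff)
  qed (use range range' y calculation in auto)
  ultimately show ?thesis
    using ceil_sum_reflect[of \<gamma>] by (intro exI[of _ \<gamma>]) auto
qed

section \<open>From avoiding orbits to confined orbits\<close>

text \<open>Below \<open>[2b - 1, 2a]\<close> the distance to 0 doubles at each step, above it the
  distance to 1 does; an orbit avoiding the hole cannot jump across this interval, nor leave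
  it.\<close>

lemma avoiding_orbit_eventually_confined:
  assumes hole: "hole a b" "a < 1 / 2" "1 / 2 < b"
    and x: "x \<in> avoiding_set a b" "0 < x" "x < 1"
  shows "\<exists>K. \<forall>n. (doubling ^^ (n + K)) x \<in> {2 * b - 1..2 * a}"
proof -
  define z where "z n = (doubling ^^ n) x" for n
  have S: "z (Suc n) = (if z n \<le> 1/2 then 2 * z n else 2 * z n - 1)" for n
    by (simp add: z_def doubling_def)
  have av: "z n \<le> a \<or> b \<le> z n" for n
    using x(1) by (auto simp: avoiding_set_def z_def not_less)
  have pos: "0 < z n \<and> z n < 1" for n
  proof (induction n)
    case 0
    with x show ?case by (simp add: z_def)
  next
    case (Suc n)
    with av[of n] hole show ?case by (auto simp: S)
  qed
  have inv: "z (Suc n) \<in> {2 * b - 1..2 * a}" if "z n \<in> {2 * b - 1..2 * a}" for n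
    using that av[of n] pos[of n] hole by (auto simp: S hole_def)
  have "\<exists>K. z K \<in> {2 * b - 1..2 * a}"
  proof (rule ccontr)
    assume no: "\<not> ?thesis"
    then have out: "z n < 2 * b - 1 \<or> 2 * a < z n" for n by (force simp: not_le)
    show False
    proof (cases "z 0 < 2 * b - 1")
      case True
      have "z n < 2 * b - 1 \<and> z n = 2 ^ n * z 0" for n
      proof (induction n)
        case (Suc n)
        then have "z n \<le> a" using av[of n] hole by (auto simp: hole_def)
        then have "z (Suc n) = 2 * z n" "z (Suc n) \<le> 2 * a" using hole by (auto simp: S)
        with Suc out[of "Suc n"] show ?case by auto
      qed (use True in simp)
      moreover obtain n where "1 / z 0 < 2 ^ n"
        using real_arch_pow[of 2 "1 / z 0"] by auto
      ultimately show False using pos[of 0] pos[of n] by (metis divide_less_eq order_less_asym)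
    next
      case False
      have "2 * a < z n \<and> 1 - z n = 2 ^ n * (1 - z 0)" for n
      proof (induction n)
        case 0
        with False out[of 0] show ?case by simp
      next
        case (Suc n)
        then have "b \<le> z n" using av[of n] hole by (auto simp: hole_def)
        then have "z (Suc n) = 2 * z n - 1" "2 * b - 1 \<le> z (Suc n)" using hole by (auto simp: S)
        with Suc out[of "Suc n"] show ?case by auto
      qed
      moreover obtain n where "1 / (1 - z 0) < 2 ^ n"
        using real_arch_pow[of 2 "1 / (1 - z 0)"] by auto
      then have "1 < 2 ^ n * (1 - z 0)" using pos[of 0] by (simp add: divide_less_eq)
      ultimately show False using pos[of n] by (metis diff_gt_0_iff_gt less_le_not_le add_increasing2 le_add_diff_inverse2 less_eq_real_def linorder_not_less)
    qed
  qed
  then obtain K where K: "z K \<in> {2 * b - 1..2 * a}" by blast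
  have "z (n + K) \<in> {2 * b - 1..2 * a}" for n
    using K inv by (induction n) auto
  then show ?thesis by (auto simp: z_def)
qed

text \<open>The confining interval \<open>[2b - 1, 2a]\<close> has length
  \<open>1 - 2(b - a)\<close>, below \<open>1/2\<close> because the hole is longer than
  \<open>1/4\<close>.\<close>

lemma ex_rotation_if_long:
  assumes hole: "hole a b" "a < 1 / 2" "1 / 2 < b" "1 / 4 < b - a"
    and ne: "avoiding_set a b \<noteq> {0, 1}"
  shows "\<exists>\<gamma>. 0 < \<gamma> \<and> \<gamma> < 1 \<and> ceil_sum \<gamma> / 4 \<le> a \<and> b \<le> 1 / 2 + floor_sum \<gamma> / 4"
proof -
  obtain x where x: "x \<in> avoiding_set a b" "0 < x" "x < 1"
    using ne avoiding_set_ne_iff[OF hole(1)] by blast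
  obtain K where K: "\<And>n. (doubling ^^ (n + K)) x \<in> {2 * b - 1..2 * a}"
    using avoiding_orbit_eventually_confined[OF hole(1-3) x] by blast
  define y where "y n = (doubling ^^ (n + K)) x" for n
  define w :: "nat \<Rightarrow> int" where "w n = (if y n \<le> 1 / 2 then 0 else 1)" for n
  have "\<exists>\<gamma>. 0 \<le> \<gamma> \<and> \<gamma> \<le> 1 \<and> ceil_sum \<gamma> \<le> 2 * (2 * a) \<and> 2 * (2 * b - 1) \<le> floor_sum \<gamma>"
  proof (rule rotation_number_of_confined_orbit[of y w])
    show "2 * b - 1 \<le> y n \<and> y n \<le> 2 * a" for n using K[of n] by (simp add: y_def)
  qed (use hole in \<open>auto simp: y_def w_def doubling_def\<close>)
  then obtain \<gamma> where \<gamma>: "0 \<le> \<gamma>" "\<gamma> \<le> 1" "ceil_sum \<gamma> \<le> 4 * a" "4 * b - 2 \<le> floor_sum \<gamma>" by auto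
  moreover have "\<gamma> \<noteq> 0" using \<gamma>(4) hole by (auto simp: floor_sum_0)
  moreover have "\<gamma> \<noteq> 1" using \<gamma>(3) hole by (auto simp: ceil_sum_1)
  ultimately show ?thesis by (intro exI[of _ \<gamma>]) auto
qed

subsection \<open>Balanced words\<close>

lemma word_value_summable: "summable (\<lambda>n. of_bool (w !! n) / 2 ^ Suc n :: real)"
proof (rule summable_comparison_test)
  show "\<exists>N. \<forall>n\<ge>N. norm (of_bool (w !! n) / 2 ^ Suc n :: real) \<le> 1 / 2 ^ n"
    by (auto simp: field_simps)
  show "summable (\<lambda>n. 1 / 2 ^ n :: real)"
    using sums_1_div_2_power by (rule sums_summable)
qed

text \<open>\<open>h\<close> is a running digit count whose start is left free, since the upper
  staircase below starts at -1. Summing \<open>h (Suc n)\<close> matches the indexing of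
  \<open>ceil_sum\<close> and \<open>floor_sum\<close>.\<close>

lemma word_value_eqI:
  fixes h :: "nat \<Rightarrow> int"
  assumes "\<And>n. of_bool (w !! n) = h (Suc n) - h n"
    and "(\<lambda>n. of_int (h (Suc n)) / 2 ^ n) sums S"
  shows "word_value w = S / 4 - of_int (h 0) / 2"
proof -
  have "(\<lambda>n. of_int (h (Suc n)) / 2 ^ n * (1 / 2)) sums (S * (1 / 2))"
    using assms(2) by (rule sums_mult2)
  then have "(\<lambda>n. of_int (h (Suc n)) / 2 ^ Suc n) sums (S / 2)"
    by (simp add: mult.commute[of 2])
  then have h: "(\<lambda>n. of_int (h n) / 2 ^ n) sums (S / 2 + of_int (h 0))"
    by (subst (asm) sums_Suc_iff[of "\<lambda>n. of_int (h n) / 2 ^ n"]) simp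
  have "of_bool (w !! n) / 2 ^ Suc n = (of_int (h (Suc n)) - of_int (h n) :: real) / 2 ^ Suc n" for n
    using arg_cong[OF assms(1)[of n], of real_of_int] by (simp del: power_Suc)
  then show ?thesis
    using suminf_diff_div_2_power[OF sums_summable[OF h]] sums_unique[OF h]
    by (simp add: word_value_def sums_iff del: power_Suc)
qed

text \<open>Replacing the initial letters 01 by 10 changes the value by
  \<open>1/2 - 1/4\<close>.\<close>

lemma word_value_swap:
  assumes "\<And>n. 2 \<le> n \<Longrightarrow> u !! n = v !! n" "\<not> u !! 0" "u !! 1" "v !! 0" "\<not> v !! 1"
  shows "word_value v = word_value u + 1 / 4"
proof -
  have split: "word_value w = (\<Sum>n. of_bool (w !! (n + 2)) / 2 ^ Suc (n + 2))
      + (of_bool (w !! 0) / 2 + of_bool (w !! 1) / 4)" for w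
    unfolding word_value_def
    by (subst suminf_split_initial_segment[OF word_value_summable, of _ 2]) (simp add: numeral_2_eq_2)
  have "u !! (n + 2) = v !! (n + 2)" for n using assms(1)[of "n + 2"] by simp
  moreover have "u !! 0 = False" "u !! 1 = True" "v !! 0 = True" "v !! 1 = False" using assms(2-) by auto
  ultimately show ?thesis
    unfolding split[of u] split[of v] by (simp only:) simp
qed

lemma snth_cycle:
  assumes "w \<noteq> []"
  shows "cycle w !! n = w ! (n mod length w)"
proof -
  have "cycle w !! n = shd (sdrop n (cycle w))" by simp
  also have "\<dots> = shd (cycle (rotate (n mod length w) w))"
    using assms by (subst sdrop_cycle) auto
  also have "\<dots> = hd (rotate (n mod length w) w)"
    using assms by (subst cycle.simps) auto
  also have "\<dots> = w ! (n mod length w)"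
    using assms by (simp add: hd_rotate_conv_nth)
  finally show ?thesis .
qed

section \<open>Cyclic balance as counting along the periodic extension\<close>

definition cyclic_digit :: "bool list \<Rightarrow> nat \<Rightarrow> int" where
  "cyclic_digit w n = of_bool (w ! (n mod length w))"

lemma count_list_True_eq_ones: "int (count_list w True) = ones (\<lambda>n. of_bool (w ! n)) 0 (length w)"
proof (induction w rule: rev_induct)
  case (snoc x xs)
  have "ones (\<lambda>n. of_bool ((xs @ [x]) ! n)) 0 (length xs) = ones (\<lambda>n. of_bool (xs ! n)) 0 (length xs)"
    unfolding ones_def by (intro sum.cong) (auto simp: nth_append)
  with snoc show ?case by (simp add: ones_Suc)
qed simp

lemma count_list_factor:
  assumes "i + m \<le> length w"
  shows "int (count_list (take m (drop i w)) True) = ones (\<lambda>n. of_bool (w ! n)) i m"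
proof -
  have "length (take m (drop i w)) = m" using assms by simp
  then show ?thesis
    unfolding count_list_True_eq_ones unfolding ones_def using assms by (intro sum.cong) auto
qed

lemma sublist_iff_take_drop:
  "sublist u w \<longleftrightarrow> (\<exists>i. i + length u \<le> length w \<and> u = take (length u) (drop i w))"
proof
  assume "sublist u w"
  then obtain xs ys where "w = xs @ u @ ys" by (auto simp: sublist_def)
  then show "\<exists>i. i + length u \<le> length w \<and> u = take (length u) (drop i w)"
    by (intro exI[of _ "length xs"]) simp
next
  assume "\<exists>i. i + length u \<le> length w \<and> u = take (length u) (drop i w)"
  then obtain i where "u = take (length u) (drop i w)" by blast
  then show "sublist u w" by (metis sublist_take sublist_drop sublist_order.order.trans)
qed

lemma balanced_word_iff:
  "balanced_word w \<longleftrightarrow> (\<forall>i j m. i + m \<le> length w \<and> j + m \<le> length w \<longrightarrow>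
     \<bar>ones (\<lambda>n. of_bool (w ! n)) i m - ones (\<lambda>n. of_bool (w ! n)) j m\<bar> \<le> 1)"
    (is "_ \<longleftrightarrow> ?R")
proof
  assume bal: "balanced_word w"
  show ?R
  proof (intro allI impI)
    fix i j m assume ij: "i + m \<le> length w \<and> j + m \<le> length w"
    then have "sublist (take m (drop i w)) w" "sublist (take m (drop j w)) w"
      "length (take m (drop i w)) = length (take m (drop j w))"
      by (auto intro: sublist_order.order.trans[OF sublist_take sublist_drop])
    with bal ij show "\<bar>ones (\<lambda>n. of_bool (w ! n)) i m - ones (\<lambda>n. of_bool (w ! n)) j m\<bar> \<le> 1"
      unfolding balanced_word_def using count_list_factor by metis
  qed
next
  assume R: ?R
  show "balanced_word w"
    unfolding balanced_word_def
  proof (intro allI impI)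
    fix u v assume uv: "sublist u w \<and> sublist v w \<and> length u = length v"
    then obtain i j where "i + length u \<le> length w" "u = take (length u) (drop i w)"
      "j + length u \<le> length w" "v = take (length u) (drop j w)"
      unfolding sublist_iff_take_drop by metis
    with R show "\<bar>int (count_list u True) - int (count_list v True)\<bar> \<le> 1"
      using count_list_factor by metis
  qed
qed

lemma cyclically_balanced_iff:
  "cyclically_balanced w \<longleftrightarrow> (\<forall>i j m. i + m \<le> 2 * length w \<and> j + m \<le> 2 * length w \<longrightarrow>
     \<bar>ones (cyclic_digit w) i m - ones (cyclic_digit w) j m\<bar> \<le> 1)"
proof -
  have digit: "of_bool ((w @ w) ! n) = cyclic_digit w n" if "n < 2 * length w" for n
    using that by (cases "n < length w") (simp_all add: cyclic_digit_def nth_append le_mod_geq)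
  have "ones (\<lambda>n. of_bool ((w @ w) ! n)) i m = ones (cyclic_digit w) i m" if "i + m \<le> 2 * length w" for i m
    unfolding ones_def using that digit by (intro sum.cong) auto
  then show ?thesis
    unfolding cyclically_balanced_def balanced_word_iff
    by (auto simp: mult_2[symmetric])
qed

lemma count_list_cyclic: "int (count_list w True) = ones (cyclic_digit w) 0 (length w)"
  unfolding count_list_True_eq_ones by (simp add: ones_def cyclic_digit_def)

text \<open>Double counting: at each of the \<open>m\<close> offsets the \<open>q\<close> starting
  points run through one full period.\<close>

lemma sum_ones_periodic:
  assumes "\<And>n. d (n + q) = d n"
  shows "(\<Sum>i<q. ones d i m) = int m * ones d 0 q"
proof -
  have shift: "ones d k q = ones d 0 q" for k
  proof (induction k)
    case (Suc k)
    have "ones d k 1 + ones d (k + 1) q = ones d k q + d (k + q)"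
      using ones_add[of d k 1 q] ones_Suc[of d k q] by simp
    with Suc assms[of k] show ?case by (simp add: ones_def)
  qed simp
  have "(\<Sum>i<q. ones d i m) = (\<Sum>k<m. \<Sum>i<q. d (i + k))"
    unfolding ones_def by (rule sum.swap)
  also have "\<dots> = (\<Sum>k<m. ones d k q)"
    by (simp add: ones_def add.commute)
  also have "\<dots> = int m * ones d 0 q" by (subst shift) simp
  finally show ?thesis .
qed

section \<open>Extremal balanced words of slope p/q\<close>

context
  fixes p q :: nat and \<gamma> :: real
  assumes pq: "0 < p" "p < q" "coprime p q"
  defines "\<gamma> \<equiv> real p / real q"
begin

lemma slope: "0 < \<gamma>" "\<gamma> < 1" "real q * \<gamma> = real p"
  using pq by (auto simp: \<gamma>_def)

lemma slope_multiple_not_int: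
  assumes "0 < j" "j < q"
  shows "real j * \<gamma> \<noteq> of_int z"
proof
  assume "real j * \<gamma> = of_int z"
  then have "real_of_int (int j * int p) = real_of_int (z * int q)"
    using pq by (simp add: \<gamma>_def field_simps)
  then have "int j * int p = z * int q" by (simp only: of_int_eq_iff)
  then have "int q dvd int (j * p)" by simp
  then have "q dvd j * p" by (simp only: int_dvd_int_iff)
  then have "q dvd j" using pq(3) by (simp add: coprime_dvd_mult_left_iff coprime_commute)
  with assms show False by (auto dest: dvd_imp_le)
qed

lemma floor_ceiling_slope_multiple:
  assumes "0 < j" "j < q"
  shows "\<lceil>real j * \<gamma>\<rceil> = \<lfloor>real j * \<gamma>\<rfloor> + 1"
  using slope_multiple_not_int[OF assms] by (simp add: ceiling_altdef)

text \<open>These become the prefix counts of \<open>omega_minus\<close> and, up to the constant -1,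
  of \<open>omega_plus\<close>. The real shift \<open>n - 1\<close> makes the words begin with 01
  and 10; at \<open>n = 0\<close> its value is \<open>-\<gamma>\<close> after scaling, whence
  \<open>upper_step 0 = -1\<close>.\<close>

definition lower_step :: "nat \<Rightarrow> int" where "lower_step n = \<lceil>(real n - 1) * \<gamma>\<rceil>"
definition upper_step :: "nat \<Rightarrow> int" where "upper_step n = \<lfloor>(real n - 1) * \<gamma>\<rfloor>"

definition staircase_word :: "(nat \<Rightarrow> int) \<Rightarrow> bool list" where
  "staircase_word h = map (\<lambda>n. h (Suc n) \<noteq> h n) [0..<q]"

lemma lower_step_0: "lower_step 0 = 0" and upper_step_0: "upper_step 0 = -1"
  and lower_step_Suc: "lower_step (Suc n) = \<lceil>real n * \<gamma>\<rceil>"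
  and upper_step_Suc: "upper_step (Suc n) = \<lfloor>real n * \<gamma>\<rfloor>"
  using slope by (auto simp: lower_step_def upper_step_def ceiling_eq_iff floor_eq_iff)

lemma step_increment:
  assumes "h = lower_step \<or> h = upper_step"
  shows "h (Suc n) - h n \<in> {0, 1}"
proof -
  have "(real (Suc n) - 1) * \<gamma> = (real n - 1) * \<gamma> + \<gamma>" by (simp add: algebra_simps)
  with slope(1,2) assms show ?thesis
    unfolding lower_step_def upper_step_def by safe linarith+
qed

lemma step_add_period:
  assumes "h = lower_step \<or> h = upper_step"
  shows "h (n + q) = h n + int p"
proof -
  have "(real (n + q) - 1) * \<gamma> = (real n - 1) * \<gamma> + of_int (int p)"
    using slope(3) by (simp add: algebra_simps)
  then show ?thesis
    using assms unfolding lower_step_def upper_step_def by (metis ceiling_add_of_int floor_add_int)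
qed

text \<open>Every increment over \<open>m\<close> steps lies strictly between
  \<open>m\<gamma> - 1\<close> and \<open>m\<gamma> + 1\<close>, and this interval contains at most
  two integers, which are then consecutive.\<close>

lemma step_balanced:
  assumes "h = lower_step \<or> h = upper_step"
  shows "\<bar>(h (i + m) - h i) - (h (j + m) - h j)\<bar> \<le> 1"
proof -
  have *: "(real (n + m) - 1) * \<gamma> = (real n - 1) * \<gamma> + real m * \<gamma>" for n by (simp add: algebra_simps)
  have "h = (\<lambda>n. \<lceil>(real n - 1) * \<gamma>\<rceil>) \<or> h = (\<lambda>n. \<lfloor>(real n - 1) * \<gamma>\<rfloor>)"
    using assms unfolding lower_step_def upper_step_def by blast
  then show ?thesis
  proof
    assume h: "h = (\<lambda>n. \<lceil>(real n - 1) * \<gamma>\<rceil>)"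
    show ?thesis unfolding h * by linarith
  next
    assume h: "h = (\<lambda>n. \<lfloor>(real n - 1) * \<gamma>\<rfloor>)"
    show ?thesis unfolding h * by linarith
  qed
qed

lemma length_staircase_word [simp]: "length (staircase_word h) = q"
  by (simp add: staircase_word_def)

lemma cyclic_digit_staircase_word:
  assumes "h = lower_step \<or> h = upper_step"
  shows "cyclic_digit (staircase_word h) n = h (Suc n) - h n"
proof -
  have "h (k + c * q) = h k + int c * int p" for k c
  proof (induction c)
    case (Suc c)
    with step_add_period[OF assms, of "k + c * q"] show ?case by (simp add: algebra_simps)
  qed simp
  from this[of "n mod q" "n div q"] this[of "Suc (n mod q)" "n div q"]
  have "h (Suc n) - h n = h (Suc (n mod q)) - h (n mod q)"
    by (simp add: mod_div_mult_eq)
  moreover have "n mod q < q" using pq by simp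
  ultimately show ?thesis
    using step_increment[OF assms, of "n mod q"] by (auto simp: cyclic_digit_def staircase_word_def)
qed

lemma ones_staircase_word:
  assumes "h = lower_step \<or> h = upper_step"
  shows "ones (cyclic_digit (staircase_word h)) i m = h (i + m) - h i"
  by (induction m) (auto simp: ones_Suc cyclic_digit_staircase_word[OF assms])

lemma staircase_word_balanced:
  assumes "h = lower_step \<or> h = upper_step"
  shows "cyclically_balanced (staircase_word h)" "count_list (staircase_word h) True = p"
proof -
  show "cyclically_balanced (staircase_word h)"
    unfolding cyclically_balanced_iff ones_staircase_word[OF assms] using step_balanced[OF assms] by blast
  have "int (count_list (staircase_word h) True) = int p"
    unfolding count_list_cyclic ones_staircase_word[OF assms]
    using step_add_period[OF assms, of 0] by simp
  then show "count_list (staircase_word h) True = p" by simp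
qed

lemma hd_staircase_word: "\<not> hd (staircase_word lower_step)" "hd (staircase_word upper_step)"
  using pq slope
  by (auto simp: staircase_word_def hd_map upt_conv_Cons lower_step_0 upper_step_0 lower_step_Suc upper_step_Suc)

text \<open>The counts differ by at most 1 and average to \<open>j\<gamma>\<close> over all cyclic shifts, which is not an
  integer.\<close>

lemma cyclically_balanced_ones:
  assumes w: "cyclically_balanced w" "length w = q" "count_list w True = p"
    and j: "0 < j" "j < q" "i < q"
  shows "\<bar>of_int (ones (cyclic_digit w) i j) - real j * \<gamma>\<bar> < 1"
proof -
  let ?o = "\<lambda>i. ones (cyclic_digit w) i j"
  have "cyclic_digit w (n + q) = cyclic_digit w n" for n
    using w by (simp add: cyclic_digit_def)
  from sum_ones_periodic[of "cyclic_digit w" q j, OF this]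
  have total: "(\<Sum>i<q. ?o i) = int j * int p"
    using count_list_cyclic[of w] w by simp
  have "real q * (real j * \<gamma>) = real_of_int (int j * int p)"
    using slope(3) by (simp add: algebra_simps)
  then have average: "(\<Sum>k<q. real j * \<gamma>) = (\<Sum>k<q. of_int (?o k))"
    by (simp add: total flip: of_int_sum)
  have bal: "\<bar>?o i - ?o k\<bar> \<le> 1" if "k < q" for k
    using w j that unfolding cyclically_balanced_iff by auto
  have "\<exists>k<q. of_int (?o k) \<le> real j * \<gamma>"
  proof (rule ccontr)
    assume "\<not> ?thesis"
    then have "(\<Sum>k<q. real j * \<gamma>) < (\<Sum>k<q. of_int (?o k))"
      using pq by (intro sum_strict_mono) (auto simp: not_le)
    with average show False by (simp only: less_irrefl)
  qed
  then obtain k where k: "k < q" "of_int (?o k) \<le> real j * \<gamma>" by blast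
  have "\<exists>k<q. real j * \<gamma> \<le> of_int (?o k)"
  proof (rule ccontr)
    assume "\<not> ?thesis"
    then have "(\<Sum>k<q. of_int (?o k)) < (\<Sum>k<q. real j * \<gamma>)"
      using pq by (intro sum_strict_mono) (auto simp: not_le)
    with average show False by (simp only: less_irrefl)
  qed
  then obtain l where l: "l < q" "real j * \<gamma> \<le> of_int (?o l)" by blast
  \<comment> \<open>The count is within 1 of counts on both sides of the average; a deviation of
    exactly 1 would make \<open>j\<gamma>\<close> an integer.\<close>
  have "real_of_int (?o i) \<le> of_int (?o k) + 1" "of_int (?o l) \<le> real_of_int (?o i) + 1"
    using bal[OF k(1)] bal[OF l(1)] by linarith+
  moreover have "real j * \<gamma> \<noteq> of_int (?o i - 1)" "real j * \<gamma> \<noteq> of_int (?o i + 1)"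
    using slope_multiple_not_int[OF j(1,2)] by blast+
  ultimately show ?thesis using k l by (simp add: abs_less_iff)
qed

text \<open>Serves to compare words at their first difference \<open>j\<close>: the window over
  positions 1 to \<open>j\<close> contains that letter, and the common prefix fixes the
  rest.\<close>

lemma ones_from_first_difference:
  assumes h: "h = lower_step \<or> h = upper_step"
    and w: "length w = q" "j < q" "0 < j" "take j w = take j (staircase_word h)"
  shows "ones (cyclic_digit w) 1 j = h (Suc j) - h 0 - of_bool (w ! 0)
    + (of_bool (w ! j) - of_bool (staircase_word h ! j))"
proof -
  let ?s = "staircase_word h"
  have "ones (cyclic_digit w) 0 j = ones (cyclic_digit ?s) 0 j"
  proof -
    have "w ! i = ?s ! i" if "i < j" for i using w(4) that by (metis nth_take)
    then show ?thesis unfolding ones_def cyclic_digit_def using w by (intro sum.cong) auto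
  qed
  moreover have "ones (cyclic_digit v) 0 (Suc j) = ones (cyclic_digit v) 0 j + of_bool (v ! j)"
    if "length v = q" for v
    using that w by (simp add: ones_Suc cyclic_digit_def)
  moreover have "ones (cyclic_digit w) 0 (Suc j) = of_bool (w ! 0) + ones (cyclic_digit w) 1 j"
    using ones_add[of "cyclic_digit w" 0 1 j] w by (simp add: ones_Suc cyclic_digit_def)
  ultimately show ?thesis
    using ones_staircase_word[OF h, of 0 "Suc j"] w by simp
qed

text \<open>A larger word has 1 against 0 at the first difference \<open>j\<close>. Its positions 1
  to \<open>j\<close> then hold \<open>\<lceil>j\<gamma>\<rceil> + 1\<close> ones, too many for a
  cyclically balanced word.\<close>

lemma staircase_word_lower_max:
  assumes w: "cyclically_balanced w" "length w = q" "count_list w True = p" "\<not> hd w"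
  shows "w \<le> staircase_word lower_step"
proof (rule ccontr)
  assume "\<not> ?thesis"
  then have "staircase_word lower_step < w" by simp
  then obtain j where j: "j < q" "take j w = take j (staircase_word lower_step)"
    "\<not> staircase_word lower_step ! j" "w ! j"
    using w by (auto simp: list_less_def lexord_take_index_conv)
  have w0: "\<not> w ! 0" using w pq by (cases w) auto
  then have "0 < j" using j by (cases j) auto
  have "ones (cyclic_digit w) 1 j = \<lceil>real j * \<gamma>\<rceil> + 1"
    using ones_from_first_difference[of lower_step w j] j w w0 \<open>0 < j\<close>
    by (simp add: lower_step_0 lower_step_Suc)
  moreover have "\<bar>of_int (ones (cyclic_digit w) 1 j) - real j * \<gamma>\<bar> < 1"
    using w j \<open>0 < j\<close> pq by (intro cyclically_balanced_ones) auto
  ultimately show False using le_of_int_ceiling[of "real j * \<gamma>"] by simp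
qed

text \<open>Dually, a smaller word would have a window with only
  \<open>\<lfloor>j\<gamma>\<rfloor> - 1\<close> ones.\<close>

lemma staircase_word_upper_min:
  assumes w: "cyclically_balanced w" "length w = q" "count_list w True = p" "hd w"
  shows "staircase_word upper_step \<le> w"
proof (rule ccontr)
  assume "\<not> ?thesis"
  then have "w < staircase_word upper_step" by simp
  then obtain j where j: "j < q" "take j w = take j (staircase_word upper_step)"
    "staircase_word upper_step ! j" "\<not> w ! j"
    using w by (auto simp: list_less_def lexord_take_index_conv)
  have w0: "w ! 0" using w pq by (cases w) auto
  then have "0 < j" using j by (cases j) auto
  have "ones (cyclic_digit w) 1 j = \<lfloor>real j * \<gamma>\<rfloor> - 1"
    using ones_from_first_difference[of upper_step w j] j w w0 \<open>0 < j\<close>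
    by (simp add: upper_step_0 upper_step_Suc)
  moreover have "\<bar>of_int (ones (cyclic_digit w) 1 j) - real j * \<gamma>\<bar> < 1"
    using w j \<open>0 < j\<close> pq by (intro cyclically_balanced_ones) auto
  ultimately show False using of_int_floor_le[of "real j * \<gamma>"] by simp
qed

lemma cycle_staircase_word:
  assumes "h = lower_step \<or> h = upper_step"
  shows "of_bool (cycle (staircase_word h) !! n) = h (Suc n) - h n"
proof -
  have "staircase_word h \<noteq> []" using pq by (simp add: staircase_word_def)
  from snth_cycle[OF this, of n] show ?thesis
    using cyclic_digit_staircase_word[OF assms, of n] by (simp add: cyclic_digit_def)
qed

lemma word_value_staircase:
  shows "word_value (cycle (staircase_word lower_step)) = ceil_sum \<gamma> / 4"
    and "word_value (cycle (staircase_word upper_step)) = 1 / 2 + floor_sum \<gamma> / 4"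
proof -
  have "word_value (cycle (staircase_word lower_step)) = ceil_sum \<gamma> / 4 - of_int (lower_step 0) / 2"
  proof (rule word_value_eqI)
    show "of_bool (cycle (staircase_word lower_step) !! n) = lower_step (Suc n) - lower_step n" for n
      by (rule cycle_staircase_word) simp
    show "(\<lambda>n. of_int (lower_step (Suc n)) / 2 ^ n) sums ceil_sum \<gamma>"
      unfolding lower_step_Suc ceil_sum_def using slope by (intro summable_sums summable_ceil_sum) auto
  qed
  then show "word_value (cycle (staircase_word lower_step)) = ceil_sum \<gamma> / 4"
    by (simp add: lower_step_0)
  have "word_value (cycle (staircase_word upper_step)) = floor_sum \<gamma> / 4 - of_int (upper_step 0) / 2"
  proof (rule word_value_eqI)
    show "of_bool (cycle (staircase_word upper_step) !! n) = upper_step (Suc n) - upper_step n" for n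
      by (rule cycle_staircase_word) simp
    show "(\<lambda>n. of_int (upper_step (Suc n)) / 2 ^ n) sums floor_sum \<gamma>"
      unfolding upper_step_Suc floor_sum_def using slope by (intro summable_sums summable_floor_sum) auto
  qed
  then show "word_value (cycle (staircase_word upper_step)) = 1 / 2 + floor_sum \<gamma> / 4"
    by (simp add: upper_step_0)
qed

text \<open>At the multiples of \<open>\<gamma>\<close> by 1 up to \<open>q - 1\<close> the ceiling
  is the floor plus 1, so both staircases rise at the same places from the third letter on.\<close>

lemma staircase_words_agree:
  assumes "2 \<le> i" "i < q"
  shows "staircase_word lower_step ! i = staircase_word upper_step ! i"
proof -
  obtain k where k: "i = Suc k" "0 < k" using assms by (cases i) auto
  have "lower_step (Suc i) = upper_step (Suc i) + 1" "lower_step i = upper_step i + 1"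
    using floor_ceiling_slope_multiple[of i] floor_ceiling_slope_multiple[of k] assms k
    by (auto simp: lower_step_Suc upper_step_Suc)
  with assms show ?thesis by (simp add: staircase_word_def)
qed

lemma staircase_words_start:
  "\<not> staircase_word lower_step ! 0" "staircase_word lower_step ! 1"
  "staircase_word upper_step ! 0" "\<not> staircase_word upper_step ! 1"
proof -
  have "\<lceil>\<gamma>\<rceil> = 1" "\<lfloor>\<gamma>\<rfloor> = 0" using slope by linarith+
  moreover have "1 < q" using pq by simp
  ultimately show "\<not> staircase_word lower_step ! 0" "staircase_word lower_step ! 1"
    "staircase_word upper_step ! 0" "\<not> staircase_word upper_step ! 1"
    using lower_step_Suc[of 0] lower_step_Suc[of 1] upper_step_Suc[of 0] upper_step_Suc[of 1]
    by (auto simp: staircase_word_def lower_step_0 upper_step_0)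
qed

lemma snth_staircase_shift_cycle:
  "(staircase_word h @- cycle (staircase_word h')) !! n
    = (if n < q then staircase_word h ! n else staircase_word h' ! (n mod q))"
proof -
  have "staircase_word h' \<noteq> []" using pq by (simp add: staircase_word_def)
  then show ?thesis by (simp add: shift_snth snth_cycle le_mod_geq)
qed

text \<open>The words \<open>s t^\<infinity>\<close> and \<open>t^\<infinity>\<close>, and likewise
  \<open>s^\<infinity>\<close> and \<open>t s^\<infinity>\<close>, differ only by 01 against 10 at
  the start.\<close>

lemma word_value_staircase_mixed:
  shows "word_value (staircase_word lower_step @- cycle (staircase_word upper_step)) = 1 / 4 + floor_sum \<gamma> / 4"
    and "word_value (staircase_word upper_step @- cycle (staircase_word lower_step)) = 1 / 4 + ceil_sum \<gamma> / 4"
proof -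
  let ?s = "staircase_word lower_step" and ?t = "staircase_word upper_step"
  have cyc: "cycle (staircase_word h) !! n = staircase_word h ! (n mod q)" for h n
    using snth_cycle[of "staircase_word h" n] pq by (simp add: staircase_word_def)
  have "1 < q" using pq by simp
  then have "word_value (cycle ?t) = word_value (?s @- cycle ?t) + 1 / 4"
    using staircase_words_start
    by (intro word_value_swap; unfold snth_staircase_shift_cycle cyc)
       (auto simp: staircase_words_agree)
  then show "word_value (?s @- cycle ?t) = 1 / 4 + floor_sum \<gamma> / 4"
    by (simp add: word_value_staircase)
  have "word_value (?t @- cycle ?s) = word_value (cycle ?s) + 1 / 4"
    using staircase_words_start \<open>1 < q\<close>
    by (intro word_value_swap; unfold snth_staircase_shift_cycle cyc)
       (auto simp: staircase_words_agree)
  then show "word_value (?t @- cycle ?s) = 1 / 4 + ceil_sum \<gamma> / 4"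
    by (simp add: word_value_staircase)
qed

lemma omega_eq_staircase_word:
  assumes "quotient_of r = (int p, int q)"
  shows "omega_minus r = staircase_word lower_step" "omega_plus r = staircase_word upper_step"
proof -
  have mem: "w \<in> balanced_words_of r \<longleftrightarrow> cyclically_balanced w \<and> length w = q \<and> count_list w True = p" for w
    using assms by (auto simp: balanced_words_of_def)
  have "finite {w :: bool list. set w \<subseteq> UNIV \<and> length w = q}"
    by (rule finite_lists_length_eq) simp
  then have fin: "finite {w \<in> balanced_words_of r. P w}" for P
    by (rule rev_finite_subset) (auto simp: mem)
  show "omega_minus r = staircase_word lower_step"
    unfolding omega_minus_def
    using fin staircase_word_lower_max staircase_word_balanced hd_staircase_word
    by (intro Max_eqI) (auto simp: mem)
  show "omega_plus r = staircase_word upper_step"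
    unfolding omega_plus_def
    using fin staircase_word_upper_min staircase_word_balanced hd_staircase_word
    by (intro Min_eqI) (auto simp: mem)
qed

end

text \<open>For \<open>\<gamma> = r\<close> this turns \<open>Delta r\<close> into
  \<open>[L \<gamma>, U \<gamma> - 1/4]\<close>.\<close>

lemma word_value_omega:
  fixes r :: rat
  assumes "0 < r" "r < 1"
  defines "s \<equiv> omega_minus r" and "t \<equiv> omega_plus r" and "\<gamma> \<equiv> real_of_rat r"
  shows "word_value (cycle s) = ceil_sum \<gamma> / 4"
    and "word_value (cycle t) = 1 / 2 + floor_sum \<gamma> / 4"
    and "word_value (s @- cycle t) = 1 / 4 + floor_sum \<gamma> / 4"
    and "word_value (t @- cycle s) = 1 / 4 + ceil_sum \<gamma> / 4"
proof -
  obtain a b where ab: "quotient_of r = (a, b)" by fastforce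
  have r: "r = of_int a / of_int b" "0 < b" "coprime a b"
    using quotient_of_div[OF ab] quotient_of_denom_pos[OF ab] quotient_of_coprime[OF ab] by auto
  have "0 < rat_of_int a / rat_of_int b" "rat_of_int a / rat_of_int b < 1"
    using assms(1,2) unfolding r(1) by auto
  with r(2) have "0 < a" "a < b" by (auto simp: zero_less_divide_iff divide_less_eq)
  define p q where "p = nat a" and "q = nat b"
  have pq: "a = int p" "b = int q" using \<open>0 < a\<close> \<open>0 < b\<close> by (auto simp: p_def q_def)
  have ctx: "0 < p" "p < q" "coprime p q"
    using \<open>0 < a\<close> \<open>a < b\<close> r(3) by (auto simp: pq)
  have \<gamma>: "\<gamma> = real p / real q"
    using r(1) by (simp add: \<gamma>_def pq of_rat_divide)
  note st = omega_eq_staircase_word[OF ctx, OF ab[unfolded pq], folded s_def t_def]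
  show "word_value (cycle s) = ceil_sum \<gamma> / 4"
    and "word_value (cycle t) = 1 / 2 + floor_sum \<gamma> / 4"
    and "word_value (s @- cycle t) = 1 / 4 + floor_sum \<gamma> / 4"
    and "word_value (t @- cycle s) = 1 / 4 + ceil_sum \<gamma> / 4"
    unfolding st \<gamma> using word_value_staircase[OF ctx] word_value_staircase_mixed[OF ctx] by auto
qed

subsection \<open>Critical holes\<close>

text \<open>The left side is \<open>4 (U \<gamma> - L \<gamma> - 1/4)\<close>. For non-integer
  \<open>n\<gamma>\<close> floor minus ceiling is -1 and cancels against \<open>1 / 2^n\<close>;
  only \<open>n = 0\<close>, worth 1, and the tail beyond \<open>M\<close> remain.\<close>

lemma floor_minus_ceil_sum_le:
  assumes \<gamma>: "0 < \<gamma>" "\<gamma> < 1" and no: "\<And>n. 0 < n \<Longrightarrow> n \<le> M \<Longrightarrow> real n * \<gamma> \<notin> \<int>"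
  shows "floor_sum \<gamma> - ceil_sum \<gamma> + 1 \<le> 1 / 2 ^ M"
proof -
  let ?f = "\<lambda>n. (real_of_int \<lfloor>real n * \<gamma>\<rfloor> - of_int \<lceil>real n * \<gamma>\<rceil>) / 2 ^ n"
  let ?g = "\<lambda>n. ?f n + 1 / 2 ^ n"
  have "?f sums (floor_sum \<gamma> - ceil_sum \<gamma>)"
    unfolding floor_sum_def ceil_sum_def diff_divide_distrib using \<gamma>
    by (intro sums_diff summable_sums summable_floor_sum summable_ceil_sum) auto
  from sums_add[OF this sums_1_div_2_power]
  have s: "?g sums (floor_sum \<gamma> - ceil_sum \<gamma> + 2)" .
  have "\<lceil>real n * \<gamma>\<rceil> = \<lfloor>real n * \<gamma>\<rfloor> + 1" if "0 < n" "n \<le> M" for n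
    using no[OF that] by (auto simp: ceiling_altdef) (metis Ints_of_int)
  then have "?g n = 0" if "0 < n" "n \<le> M" for n
    using that by simp
  then have "(\<Sum>n<Suc M. ?g n) = (\<Sum>n\<in>{0}. ?g n)"
    by (intro sum.mono_neutral_right) auto
  then have "(\<Sum>n<Suc M. ?g n) = 1" by simp
  then have 1: "(\<lambda>n. ?g (n + Suc M)) sums (floor_sum \<gamma> - ceil_sum \<gamma> + 2 - 1)"
    using sums_split_initial_segment[OF s, of "Suc M"] by simp
  have 2: "?g (n + Suc M) \<le> 1 / 2 ^ n * (1 / 2 ^ Suc M)" for n
  proof -
    have "real_of_int \<lfloor>real (n + Suc M) * \<gamma>\<rfloor> - of_int \<lceil>real (n + Suc M) * \<gamma>\<rceil> \<le> 0"
      using floor_le_ceiling[of "real (n + Suc M) * \<gamma>"] by linarith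
    then have "?f (n + Suc M) \<le> 0"
      by (rule divide_nonpos_pos) simp
    moreover have "1 / 2 ^ (n + Suc M) = 1 / 2 ^ n * (1 / 2 ^ Suc M :: real)"
      by (simp add: power_add)
    ultimately show ?thesis by linarith
  qed
  have 3: "(\<lambda>n. 1 / 2 ^ n * (1 / 2 ^ Suc M)) sums (2 * (1 / 2 ^ Suc M) :: real)"
    by (intro sums_mult2 sums_1_div_2_power)
  have "floor_sum \<gamma> - ceil_sum \<gamma> + 2 - 1 \<le> 2 * (1 / 2 ^ Suc M)"
    using 2 1 3 by (rule sums_le)
  then show ?thesis by simp
qed

text \<open>A gap above \<open>1 / 2^M\<close> forces \<open>n\<gamma>\<close> to be an integer for
  some \<open>0 < n \<le> M\<close>, which leaves finitely many fractions.\<close>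

lemma finite_large_gaps:
  assumes "0 < \<delta>"
  shows "finite {\<gamma>. 0 < \<gamma> \<and> \<gamma> < 1 \<and> \<delta> \<le> floor_sum \<gamma> - ceil_sum \<gamma> + 1}" (is "finite ?G")
    and "{\<gamma>. 0 < \<gamma> \<and> \<gamma> < 1 \<and> \<delta> \<le> floor_sum \<gamma> - ceil_sum \<gamma> + 1} \<subseteq> \<rat>"
proof -
  obtain M where M: "1 / \<delta> < 2 ^ M"
    using real_arch_pow[of 2 "1 / \<delta>"] by auto
  then have "1 / 2 ^ M < \<delta>" using assms by (simp add: field_simps)
  have sub: "?G \<subseteq> (\<lambda>(i, n). real_of_int i / real n) ` ({0..int M} \<times> {..M})"
  proof
    fix \<gamma> assume \<gamma>: "\<gamma> \<in> ?G"
    with \<open>1 / 2 ^ M < \<delta>\<close> floor_minus_ceil_sum_le[of \<gamma> M]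
    obtain n where n: "0 < n" "n \<le> M" "real n * \<gamma> \<in> \<int>" by force
    then obtain i where i: "real n * \<gamma> = of_int i" by (auto elim: Ints_cases)
    have "0 \<le> real n * \<gamma>" "real n * \<gamma> \<le> real n" using \<gamma> by (auto simp: mult_left_le)
    then have "0 \<le> i" "i \<le> int M" using n unfolding i by linarith+
    moreover have "\<gamma> = of_int i / real n" using i n by (simp add: field_simps)
    ultimately show "\<gamma> \<in> (\<lambda>(i, n). real_of_int i / real n) ` ({0..int M} \<times> {..M})"
      using n by (intro image_eqI[of _ _ "(i, n)"]) auto
  qed
  then show "finite ?G" by (rule finite_subset) simp
  show "?G \<subseteq> \<rat>" by (rule subset_trans[OF sub]) auto
qed

text \<open>Each slightly smaller hole has a slope whose gap is bounded below. Only finitely many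
  slopes have such a gap, so one of them serves for arbitrarily small shrinkings and thus in the
  limit; the positive gap also makes it rational.\<close>

lemma critical_long:
  assumes hole: "hole a b" "a < 1 / 2" "1 / 2 < b" "1 / 4 < b - a"
    and ne: "\<And>a' b'. hole a' b' \<Longrightarrow> a < a' \<Longrightarrow> b' < b \<Longrightarrow> avoiding_set a' b' \<noteq> {0, 1}"
  shows "\<exists>\<gamma>\<in>\<rat>. 0 < \<gamma> \<and> \<gamma> < 1 \<and> ceil_sum \<gamma> / 4 \<le> a \<and> b \<le> 1 / 2 + floor_sum \<gamma> / 4"
proof -
  \<comment> \<open>Half the excess over \<open>1/4\<close>: shrinking each end by less than
    \<open>\<delta> / 2\<close> leaves a length of at least \<open>1/4 + \<delta>\<close>.\<close>
  define \<delta> where "\<delta> = (b - a - 1 / 4) / 2"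
  have \<delta>: "0 < \<delta>" using hole by (simp add: \<delta>_def)
  let ?G = "{\<gamma>. 0 < \<gamma> \<and> \<gamma> < 1 \<and> 4 * \<delta> \<le> floor_sum \<gamma> - ceil_sum \<gamma> + 1}"
  have "\<exists>\<gamma>\<in>?G. ceil_sum \<gamma> / 4 \<le> a \<and> b \<le> 1 / 2 + floor_sum \<gamma> / 4"
  proof (rule ccontr)
    assume no: "\<not> ?thesis"
    have "\<forall>\<^sub>F e in at_right 0. a + e < ceil_sum \<gamma> / 4 \<or> 1 / 2 + floor_sum \<gamma> / 4 < b - e"
      if "\<gamma> \<in> ?G" for \<gamma>
    proof (cases "a < ceil_sum \<gamma> / 4")
      case True
      then have "0 < ceil_sum \<gamma> / 4 - a" by simp
      from eventually_at_right_real[OF this] show ?thesis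
        by eventually_elim auto
    next
      case False
      then have "\<not> b \<le> 1 / 2 + floor_sum \<gamma> / 4" using no that by (meson not_less)
      then have "0 < b - (1 / 2 + floor_sum \<gamma> / 4)" by simp
      from eventually_at_right_real[OF this] show ?thesis
        by eventually_elim auto
    qed
    \<comment> \<open>Finiteness of \<open>?G\<close> allows every small enough \<open>e\<close> to
      defeat all its slopes at once.\<close>
    then have 1: "\<forall>\<^sub>F e in at_right 0. \<forall>\<gamma>\<in>?G. a + e < ceil_sum \<gamma> / 4 \<or> 1 / 2 + floor_sum \<gamma> / 4 < b - e"
      using finite_large_gaps(1)[of "4 * \<delta>"] \<delta> by (intro eventually_ball_finite) auto
    have "0 < min (\<delta> / 2) (min (1 / 2 - a) (b - 1 / 2))" using \<delta> hole by simp
    from eventually_at_right_real[OF this] 1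
    have "\<forall>\<^sub>F e in at_right (0::real). False"
    proof eventually_elim
      case (elim e)
      have h: "hole (a + e) (b - e)" "a + e < 1 / 2" "1 / 2 < b - e" "1 / 4 + \<delta> \<le> (b - e) - (a + e)"
        using elim(1) hole \<delta> by (auto simp: hole_def \<delta>_def field_simps)
      then obtain \<gamma> where \<gamma>: "0 < \<gamma>" "\<gamma> < 1" "ceil_sum \<gamma> / 4 \<le> a + e" "b - e \<le> 1 / 2 + floor_sum \<gamma> / 4"
        using ex_rotation_if_long[of "a + e" "b - e"] ne[of "a + e" "b - e"] elim(1) \<delta> by auto
      with h have "\<gamma> \<in> ?G" by simp
      with elim(2) \<gamma> show ?case by fastforce
    qed
    then show False by simp
  qed
  then show ?thesis using finite_large_gaps(2)[of "4 * \<delta>"] \<delta> by fastforce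
qed

section \<open>Classification of critical holes\<close>

text \<open>The branch chosen at \<open>1/2\<close> sends it to the fixed point 1, so its orbit
  misses every hole not containing \<open>1/2\<close>.\<close>

lemma half_in_avoiding_set:
  assumes "b \<le> 1 / 2 \<or> 1 / 2 \<le> a" "hole a b"
  shows "avoiding_set a b \<noteq> {0, 1}"
proof -
  have "(1 / 2 :: real) \<in> avoiding_set a b"
    by (rule avoiding_set_invariant[where A = "{1 / 2, 1}"])
       (use assms in \<open>auto simp: hole_def doubling_def\<close>)
  then show ?thesis using avoiding_set_ne_iff[OF assms(2)] by force
qed

text \<open>A larger hole is longer than \<open>1/4\<close>, contains \<open>1/2\<close> and starts
  below \<open>1/4\<close>, whereas \<open>L \<gamma> \<ge> 1/4\<close> for every slope; a smaller
  one misses the orbit of \<open>1/2\<close>. This family realizes all the required lengths.\<close>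

lemma FOCH_half:
  assumes "0 < c" "c \<le> 1 / 4"
  shows "FOCH c (1 / 2)"
  unfolding FOCH_def
proof (intro conjI allI impI)
  show "hole c (1 / 2)" using assms by (simp add: hole_def)
next
  fix a b :: real assume ab: "hole a b \<and> a < c \<and> b > 1 / 2"
  show "avoiding_set a b = {0, 1}"
  proof (rule ccontr)
    assume "avoiding_set a b \<noteq> {0, 1}"
    then obtain \<gamma> where "0 < \<gamma>" "\<gamma> < 1" "ceil_sum \<gamma> / 4 \<le> a"
      using ex_rotation_if_long[of a b] ab assms by auto
    with ceil_sum_ge_1[of \<gamma>] ab assms show False by simp
  qed
next
  fix a b :: real assume "hole a b \<and> a > c \<and> b < 1 / 2"
  then show "avoiding_set a b \<noteq> {0, 1}" using half_in_avoiding_set by simp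
qed

text \<open>A hole in any other position can be enlarged with the avoiding set staying nontrivial:
  either it lies strictly to one side of \<open>1/2\<close>, or its closure contains
  \<open>1/2\<close> and it is shorter than \<open>1/4\<close>.\<close>

lemma FOCH_cases:
  assumes "FOCH a b"
  shows "(b = 1 / 2 \<and> a \<le> 1 / 4) \<or> (a = 1 / 2 \<and> 3 / 4 \<le> b)
    \<or> (1 / 4 < a \<and> a < 1 / 2 \<and> b = a + 1 / 4)
    \<or> (a < 1 / 2 \<and> 1 / 2 < b \<and> a + 1 / 4 < b)"
proof (rule ccontr)
  assume neg: "\<not> ?thesis"
  have h: "0 < a" "a < b" "b < 1" using assms by (auto simp: FOCH_def hole_def)
  have larger: "avoiding_set a' b' = {0, 1}" if "hole a' b'" "a' < a" "b < b'" for a' b'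
    using assms that by (auto simp: FOCH_def)
  consider "b < 1 / 2" | "1 / 2 < a" | "a \<le> 1 / 2" "1 / 2 \<le> b" "b < a + 1 / 4"
    using neg h by linarith
  then show False
  proof cases
    case 1
    have "hole (a / 2) ((b + 1 / 2) / 2)" using 1 h by (simp add: hole_def)
    with larger[OF this] half_in_avoiding_set[of "(b + 1 / 2) / 2" "a / 2"] 1 h show False by simp
  next
    case 2
    have "hole ((a + 1 / 2) / 2) ((b + 1) / 2)" using 2 h by (simp add: hole_def)
    with larger[OF this] half_in_avoiding_set[of "(b + 1) / 2" "(a + 1 / 2) / 2"] 2 h show False by simp
  next
    case 3
    \<comment> \<open>A third of the slack: the enlarged hole has length \<open>1/4 - e\<close>, and
      \<open>a - e > 1/4\<close> because \<open>b \<ge> 1/2\<close>.\<close>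
    define e where "e = (a + 1 / 4 - b) / 3"
    have e: "0 < e" "a - e > 1 / 4" "a - e < 1 / 2" "b + e < 1" "(b + e) - (a - e) \<le> 1 / 4"
      using 3 by (auto simp: e_def field_simps)
    have "hole (a - e) (b + e)" using e h by (simp add: hole_def)
    with larger[OF this] avoiding_set_ne_if_short[OF this] e show False by simp
  qed
qed

text \<open>Otherwise moving both ends halfway towards \<open>L \<gamma>\<close> and
  \<open>U \<gamma>\<close> gives a larger hole still avoided by a rotation orbit.\<close>

lemma FOCH_not_inside:
  assumes "FOCH a b" "0 < \<gamma>" "\<gamma> < 1"
  shows "a \<le> ceil_sum \<gamma> / 4 \<or> 1 / 2 + floor_sum \<gamma> / 4 \<le> b"
proof (rule ccontr)
  assume "\<not> ?thesis"
  then have lt: "ceil_sum \<gamma> / 4 < a" "b < 1 / 2 + floor_sum \<gamma> / 4" by auto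
  have h: "0 < a" "a < b" "b < 1" using assms(1) by (auto simp: FOCH_def hole_def)
  \<comment> \<open>The cap at 1 ensures \<open>b' < 1\<close>.\<close>
  define a' b' where "a' = (ceil_sum \<gamma> / 4 + a) / 2" and "b' = (b + min 1 (1 / 2 + floor_sum \<gamma> / 4)) / 2"
  have ab': "a' < a" "b < b'" "ceil_sum \<gamma> / 4 \<le> a'" "b' \<le> 1 / 2 + floor_sum \<gamma> / 4" "hole a' b'"
    using lt h ceil_sum_ge_1[of \<gamma>] assms(2,3) by (auto simp: a'_def b'_def hole_def min_def)
  then have "avoiding_set a' b' \<noteq> {0, 1}"
    using assms by (intro mechanical_avoids[of \<gamma>]) auto
  with ab' assms(1) show False by (auto simp: FOCH_def)
qed

theorem theorem3p7:
  shows "(\<forall>a b. FOCH a b \<longrightarrow>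
            (\<exists>c\<in>{0<..1/4}. (a = c \<and> b = 1/2) \<or> (a = 1/2 \<and> b = 1 - c))
          \<or> (a \<in> S_set \<and> b = a + 1/4)
          \<or> (\<exists>r\<in>{0<..<1}. \<exists>s t. s = omega_minus r \<and> t = omega_plus r
               \<and> a = word_value (cycle s)
               \<and> b \<in> {word_value (t @- cycle s) .. word_value (cycle t)})
          \<or> (\<exists>r\<in>{0<..<1}. \<exists>s t. s = omega_minus r \<and> t = omega_plus r
               \<and> a \<in> {word_value (cycle s) <.. word_value (s @- cycle t)}
               \<and> b = word_value (cycle t)))
       \<and> (\<forall>l\<in>{1/4..<1/2}. \<exists>a b. FOCH a b \<and> b - a = l)"
proof (intro conjI allI impI ballI)
  fix l :: real assume "l \<in> {1/4..<1/2}"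
  then have "FOCH (1 / 2 - l) (1 / 2)" by (intro FOCH_half) auto
  then show "\<exists>a b. FOCH a b \<and> b - a = l" by force
next
  fix a b :: real assume foch: "FOCH a b"
  then have h: "0 < a" "a < b" "b < 1" by (auto simp: FOCH_def hole_def)
  let ?half = "\<exists>c\<in>{0<..1/4}. (a = c \<and> b = 1/2) \<or> (a = 1/2 \<and> b = 1 - c)"
  let ?S = "a \<in> S_set \<and> b = a + 1/4"
  let ?left = "\<lambda>r. \<exists>s t. s = omega_minus r \<and> t = omega_plus r
               \<and> a = word_value (cycle s)
               \<and> b \<in> {word_value (t @- cycle s) .. word_value (cycle t)}"
  let ?right = "\<lambda>r. \<exists>s t. s = omega_minus r \<and> t = omega_plus r
               \<and> a \<in> {word_value (cycle s) <.. word_value (s @- cycle t)}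
               \<and> b = word_value (cycle t)"
  \<comment> \<open>Not lying strictly inside \<open>(L, U)\<close> leaves two options:
    \<open>a = L\<close>, where \<open>a + 1/4 \<le> b\<close> becomes the lower bound
    \<open>t s^\<infinity>\<close> on \<open>b\<close>, or \<open>b = U\<close> with
    \<open>a\<close> beyond \<open>L\<close>.\<close>
  have plateau: "?left r \<or> ?right r"
    if r: "r \<in> {0<..<1}" and "a + 1 / 4 \<le> b"
      "ceil_sum (of_rat r) / 4 \<le> a" "a \<le> 1 / 4 + floor_sum (of_rat r) / 4"
      "b \<le> 1 / 2 + floor_sum (of_rat r) / 4" for r
  proof -
    have "a \<le> ceil_sum (of_rat r) / 4 \<or> 1 / 2 + floor_sum (of_rat r) / 4 \<le> b"
      using FOCH_not_inside[OF foch, of "of_rat r"] r by simp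
    then have "a = ceil_sum (of_rat r) / 4 \<or> (ceil_sum (of_rat r) / 4 < a \<and> b = 1 / 2 + floor_sum (of_rat r) / 4)"
      using that by linarith
    then show ?thesis
      using that word_value_omega[of r] by auto
  qed
  consider "b = 1 / 2" "a \<le> 1 / 4" | "a = 1 / 2" "3 / 4 \<le> b"
    | "1 / 4 < a" "a < 1 / 2" "b = a + 1 / 4"
    | "a < 1 / 2" "1 / 2 < b" "a + 1 / 4 < b"
    using FOCH_cases[OF foch] by blast
  then show "?half \<or> ?S \<or> (\<exists>r\<in>{0<..<1}. ?left r) \<or> (\<exists>r\<in>{0<..<1}. ?right r)"
  proof cases
    case 1
    then have ?half using h by (intro bexI[of _ a]) auto
    then show ?thesis ..
  next
    case 2
    then have ?half using h by (intro bexI[of _ "1 - b"]) auto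
    then show ?thesis ..
  next
    case 3
    show ?thesis
    proof (cases "a \<in> S_set")
      case False
      \<comment> \<open>Outside \<open>S_set\<close> the point \<open>a\<close> lies in some
        \<open>Delta r\<close>, and \<open>a \<le> U - 1/4\<close> gives
        \<open>b \<le> U\<close>.\<close>
      with 3 obtain r where r: "r \<in> {0<..<1}" "a \<in> Delta r"
        by (auto simp: S_set_def)
      then have "ceil_sum (of_rat r) / 4 \<le> a" "a \<le> 1 / 4 + floor_sum (of_rat r) / 4"
        using word_value_omega[of r] by (auto simp: Delta_def)
      with plateau[OF r(1)] 3 r(1) show ?thesis by auto
    qed (use 3 in blast)
  next
    case 4
    \<comment> \<open>A long critical hole has a rational slope with \<open>L \<le> a\<close> and
      \<open>b \<le> U\<close>; its length above \<open>1/4\<close> then puts \<open>a\<close> below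
      \<open>U - 1/4\<close>.\<close>
    have "hole a b" using h by (simp add: hole_def)
    then obtain \<gamma> where \<gamma>: "\<gamma> \<in> \<rat>" "0 < \<gamma>" "\<gamma> < 1" "ceil_sum \<gamma> / 4 \<le> a" "b \<le> 1 / 2 + floor_sum \<gamma> / 4"
      using critical_long[of a b] foch 4 by (auto simp: FOCH_def)
    then obtain r where r: "\<gamma> = of_rat r" by (auto elim: Rats_cases)
    with \<gamma> have "r \<in> {0<..<1}" by simp
    with plateau[OF this] \<gamma> r 4 show ?thesis by auto
  qed
qed

end
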